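(* Let $\Lambda$ be a space with measure $\mu$. Suppose that a quaternion kernel $K(x,y)$ on $\Lambda$ is finite-rank, quasi-real and completely positive, with diagonal form $K(x,y)=\sum_{k}\lambda_k u_k(x)u_k^{*}(y)$ (a finite sum). Assume that all $\lambda_k\in[0,1]$. Then the kernel $K(x,y)$ defines a Pfaffian point field; that is, there is a $\Lambda$-valued random point field whose correlation functions with respect to $\mu$ are $R_m(x_1,\ldots,x_m)=\mathrm{Det}_M\left(K(x_i,x_j)\right)_{1\le i,j\le m}$, $m=1,2,\ldots$.
   Context: Quaternions. "Quaternions" are complexified quaternions $q=s+x\mathbf{i}+y\mathbf{j}+z\mathbf{k}\in\mathbb{Q}_{\mathbb{C}}$ with $s,x,y,z\in\mathbb{C}$ (usual quaternion multiplication rules, complex scalars central). The conjugate is $q^{*}=s-x\mathbf{i}-y\mathbf{j}-z\mathbf{k}$ (the coefficients are not complex-conjugated). The dual $X^*$ of a quaternion matrix is given by $(X^* )_{lk}=(X_{kl})^*$; $X$ is self-dual if $X^*=X$. A quaternion kernel $K:\Lambda\times\Lambda\to\mathbb{Q}_{\mathbb{C}}$ is self-dual if $K(y,x)=K(x,y)^*$. Moore-Dyson determinant. For an $n\times n$ quaternion matrix $X$, write each permutation $\sigma\in S_n$ as a product of cycles $\sigma=(n_1i_2\ldots i_s)(n_2j_2\ldots j_t)\ldots(n_rk_2\ldots k_l)$ where $n_i$ is the largest element of its cycle and $n_1>n_2>\ldots>n_r$. Then $\mathrm{Det}_M(X)=\sum_{\sigma}(-1)^{n-r}\left(X_{n_1i_2}X_{i_2i_3}\ldots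 X_{i_sn_1}\right)\ldots\left(X_{n_rk_2}X_{k_2k_3}\ldots X_{k_ln_r}\right)$. It is scalar for self-dual $X$. Random point fields. A random point field on $\Lambda$ is a probability measure on the space of countable configurations of points of $\Lambda$ (with finitely many points in every compact subset). $\#(A)$ is the number of points in $A$. A locally integrable $R_k:\Lambda^k\to\mathbb{R}_+$ is the $k$-point correlation function with respect to $\mu$ if for all disjoint measurable $A_1,\ldots,A_m\subset\Lambda$ and non-negative integers $k_i$ with $\sum k_i=k$: $\mathbb{E}\prod_{i=1}^m[\#(A_i)\cdots(\#(A_i)-k_i+1)]=\int_{A_1^{k_1}\times\cdots\times A_m^{k_m}}R_k\,d\mu(x_1)\cdots d\mu(x_k)$. Correlation functions are defined up to sets of measure $0$. The field is Pfaffian with kernel $K$ if $K$ is a self-dual quaternion kernel and $R_m(x_1,\ldots,x_m)=\mathrm{Det}_M(K(x_i,x_j))_{1\le i,j\le m}$ for all $m\ge1$. Diagonal forms and positivity. $K$ has a diagonal form with eigenvalues $\lambda_k$ if $K(x,y)=\sum_k\lambda_ku_k(x)u_k^*(y)$ with scalar $\lambda_k$ and $u_k:\Lambda\to\mathbb{Q}_{\mathbb{C}}$ orthonormal: $\int_\Lambda u_k^*(x)u_l(x)\,d\mu(x)=\delta_{kl}$. It is quasi-real if it has a diagonal form with real eigenvalues. A kernel $K$ is positive if $\mathrm{Det}_M(K(x_i,x_j))_{1\le i,j\le m}\ge0$ for all $m\ge 1$ and all $x_1,\ldots,x_m\in\Lambda$. A quasi-real kernel $K$ with orthonormal set of eigenfunctions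 $\{u_i\}$ (those of its diagonal form) is completely positive if, for every subset $I$ of the set of indices of all eigenfunctions, the kernel $K_I(x,y)=\sum_{i\in I}u_i(x)u_i^*(y)$ is positive. *)

theory Defs
  imports "HOL-Probability.Probability" "HOL-Combinatorics.Orbits"
begin

section \<open>Complexified quaternions\<close>

text \<open>\<open>CQuat s x y z\<close> is s + x i + y j + z k with complex coefficients.\<close>

datatype cquat = CQuat (cq_s: complex) (cq_x: complex) (cq_y: complex) (cq_z: complex)

instantiation cquat :: ring_1
begin

definition "0 = CQuat 0 0 0 0"

definition "1 = CQuat 1 0 0 0"

definition "p + q = CQuat (cq_s p + cq_s q) (cq_x p + cq_x q) (cq_y p + cq_y q) (cq_z p + cq_z q)"

definition "p - q = CQuat (cq_s p - cq_s q) (cq_x p - cq_x q) (cq_y p - cq_y q) (cq_z p - cq_z q)"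

definition "- q = CQuat (- cq_s q) (- cq_x q) (- cq_y q) (- cq_z q)"

definition "p * q = CQuat
  (cq_s p * cq_s q - cq_x p * cq_x q - cq_y p * cq_y q - cq_z p * cq_z q)
  (cq_s p * cq_x q + cq_x p * cq_s q + cq_y p * cq_z q - cq_z p * cq_y q)
  (cq_s p * cq_y q - cq_x p * cq_z q + cq_y p * cq_s q + cq_z p * cq_x q)
  (cq_s p * cq_z q + cq_x p * cq_y q - cq_y p * cq_x q + cq_z p * cq_s q)"

instance
  by standard
    (simp_all add: zero_cquat_def one_cquat_def plus_cquat_def minus_cquat_def
      uminus_cquat_def times_cquat_def algebra_simps)

end

definition cq_scalar :: "complex \<Rightarrow> cquat" where
  "cq_scalar c = CQuat c 0 0 0"

text \<open>The quaternion conjugate; the complex coefficients are not conjugated.\<close>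

definition cq_conj :: "cquat \<Rightarrow> cquat" where
  "cq_conj q = CQuat (cq_s q) (- cq_x q) (- cq_y q) (- cq_z q)"

definition cq_nonneg :: "cquat \<Rightarrow> bool" where
  "cq_nonneg q \<longleftrightarrow> (\<exists>r\<ge>0. q = cq_scalar (complex_of_real r))"

definition cq_measurable :: "'a measure \<Rightarrow> ('a \<Rightarrow> cquat) \<Rightarrow> bool" where
  "cq_measurable M f \<longleftrightarrow>
     (\<lambda>x. cq_s (f x)) \<in> borel_measurable M \<and> (\<lambda>x. cq_x (f x)) \<in> borel_measurable M \<and>
     (\<lambda>x. cq_y (f x)) \<in> borel_measurable M \<and> (\<lambda>x. cq_z (f x)) \<in> borel_measurable M"

definition cq_has_integral :: "'a measure \<Rightarrow> ('a \<Rightarrow> cquat) \<Rightarrow> cquat \<Rightarrow> bool" where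
  "cq_has_integral M f q \<longleftrightarrow>
     has_bochner_integral M (\<lambda>x. cq_s (f x)) (cq_s q) \<and>
     has_bochner_integral M (\<lambda>x. cq_x (f x)) (cq_x q) \<and>
     has_bochner_integral M (\<lambda>x. cq_y (f x)) (cq_y q) \<and>
     has_bochner_integral M (\<lambda>x. cq_z (f x)) (cq_z q)"


section \<open>The Moore-Dyson determinant\<close>

text \<open>
  Matrices of size n are functions of two indices below n. A cycle of a permutation is
  represented by its largest element (its leader); a fixed point is a cycle of length one.
\<close>

definition cycle_leaders :: "nat \<Rightarrow> (nat \<Rightarrow> nat) \<Rightarrow> nat set" where
  "cycle_leaders n \<sigma> = {a \<in> {..<n}. \<forall>b \<in> orbit \<sigma> a. b \<le> a}"

text \<open>The product of the entries of X along the cycle of \<open>\<sigma>\<close> through a, starting from a.\<close>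

definition cycle_product :: "(nat \<Rightarrow> nat \<Rightarrow> cquat) \<Rightarrow> (nat \<Rightarrow> nat) \<Rightarrow> nat \<Rightarrow> cquat" where
  "cycle_product X \<sigma> a =
     prod_list (map (\<lambda>t. X ((\<sigma> ^^ t) a) ((\<sigma> ^^ Suc t) a)) [0..<card (orbit \<sigma> a)])"

text \<open>The cycles are multiplied in decreasing order of their leaders.\<close>

definition moore_dyson_det :: "nat \<Rightarrow> (nat \<Rightarrow> nat \<Rightarrow> cquat) \<Rightarrow> cquat" where
  "moore_dyson_det n X =
     (\<Sum>\<sigma> | \<sigma> permutes {..<n}.
        (-1) ^ (n - card (cycle_leaders n \<sigma>)) *
        prod_list (map (cycle_product X \<sigma>) (rev (sorted_list_of_set (cycle_leaders n \<sigma>)))))"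


section \<open>Random point fields\<close>

text \<open>The underlying space is \<open>\<Lambda> = space \<mu>\<close>, with the topology of its type.\<close>

definition configurations :: "'a::topological_space set \<Rightarrow> 'a set set" where
  "configurations \<Lambda> =
     {\<xi>. \<xi> \<subseteq> \<Lambda> \<and> countable \<xi> \<and> (\<forall>C. compact C \<and> C \<subseteq> \<Lambda> \<longrightarrow> finite (\<xi> \<inter> C))}"

definition num_points :: "'a set \<Rightarrow> 'a set \<Rightarrow> ennreal" where
  "num_points A \<xi> = emeasure (count_space UNIV) (\<xi> \<inter> A)"

text \<open>Configurations carry the sigma-algebra generated by the counting maps of all measurable sets.\<close>

definition configuration_space :: "'a::topological_space measure \<Rightarrow> 'a set measure" where
  "configuration_space \<mu> = sigma (configurations (space \<mu>))
     {{\<xi> \<in> configurations (space \<mu>). num_points A \<xi> \<in> B} | A B. A \<in> sets \<mu> \<and> B \<in> sets borel}"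

definition random_point_field :: "'a::topological_space measure \<Rightarrow> 'a set measure \<Rightarrow> bool" where
  "random_point_field \<mu> P \<longleftrightarrow>
     prob_space P \<and> space P = space (configuration_space \<mu>) \<and>
     sets P = sets (configuration_space \<mu>)"

text \<open>
  Functions on \<open>\<Lambda>\<^sup>k\<close> are functions on the extensional product over \<open>{..<k}\<close>. A compact subset
  of \<open>\<Lambda>\<^sup>k\<close> is contained in a power of a compact subset of \<open>\<Lambda>\<close>, so it suffices to test
  integrability on powers. Testing measurable subsets of compact sets avoids assuming that
  compact sets are measurable.
\<close>

definition locally_integrable ::
  "'a::topological_space measure \<Rightarrow> nat \<Rightarrow> ((nat \<Rightarrow> 'a) \<Rightarrow> real) \<Rightarrow> bool" where
  "locally_integrable \<mu> k R \<longleftrightarrow>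
     R \<in> borel_measurable (PiM {..<k} (\<lambda>_. \<mu>)) \<and>
     (\<forall>C A. compact C \<and> C \<subseteq> space \<mu> \<and> A \<in> sets \<mu> \<and> A \<subseteq> C \<longrightarrow>
        set_integrable (PiM {..<k} (\<lambda>_. \<mu>)) (PiE {..<k} (\<lambda>_. A)) R)"

text \<open>
  The list \<open>concat \<dots>\<close> repeats each \<open>A i\<close> exactly \<open>l i\<close> times, so the domain of integration
  is \<open>A\<^sub>0\<close> to the power \<open>l\<^sub>0\<close>, times \<open>A\<^sub>1\<close> to the power \<open>l\<^sub>1\<close>, and so on. Both sides may be infinite.
  The truncated subtraction is harmless: once it truncates, the product already
  contains the factor 0.
\<close>

definition correlation_function ::
  "'a::topological_space measure \<Rightarrow> 'a set measure \<Rightarrow> nat \<Rightarrow> ((nat \<Rightarrow> 'a) \<Rightarrow> real) \<Rightarrow> bool" where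
  "correlation_function \<mu> P k R \<longleftrightarrow>
     (\<forall>x \<in> PiE {..<k} (\<lambda>_. space \<mu>). 0 \<le> R x) \<and>
     locally_integrable \<mu> k R \<and>
     (\<forall>m (A :: nat \<Rightarrow> 'a set) (l :: nat \<Rightarrow> nat).
        (\<forall>i<m. A i \<in> sets \<mu>) \<and> disjoint_family_on A {..<m} \<and> (\<Sum>i<m. l i) = k \<longrightarrow>
        (\<integral>\<^sup>+ \<xi>. (\<Prod>i<m. \<Prod>j<l i. num_points (A i) \<xi> - of_nat j) \<partial>P) =
        (\<integral>\<^sup>+ x \<in> PiE {..<k} (\<lambda>j. concat (map (\<lambda>i. replicate (l i) (A i)) [0..<m]) ! j).
           ennreal (R x) \<partial>PiM {..<k} (\<lambda>_. \<mu>)))"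


section \<open>Quaternion kernels\<close>

definition self_dual_kernel :: "'a set \<Rightarrow> ('a \<Rightarrow> 'a \<Rightarrow> cquat) \<Rightarrow> bool" where
  "self_dual_kernel \<Lambda> K \<longleftrightarrow> (\<forall>x\<in>\<Lambda>. \<forall>y\<in>\<Lambda>. K y x = cq_conj (K x y))"

definition pfaffian_point_field ::
  "'a::topological_space measure \<Rightarrow> ('a \<Rightarrow> 'a \<Rightarrow> cquat) \<Rightarrow> 'a set measure \<Rightarrow> bool" where
  "pfaffian_point_field \<mu> K P \<longleftrightarrow>
     random_point_field \<mu> P \<and> self_dual_kernel (space \<mu>) K \<and>
     (\<forall>m\<ge>1. \<exists>R. correlation_function \<mu> P m R \<and>
        (\<forall>x \<in> PiE {..<m} (\<lambda>_. space \<mu>).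
           cq_scalar (complex_of_real (R x)) = moore_dyson_det m (\<lambda>i j. K (x i) (x j))))"

definition positive_kernel :: "'a set \<Rightarrow> ('a \<Rightarrow> 'a \<Rightarrow> cquat) \<Rightarrow> bool" where
  "positive_kernel \<Lambda> K \<longleftrightarrow>
     (\<forall>m\<ge>1. \<forall>x :: nat \<Rightarrow> 'a. (\<forall>i<m. x i \<in> \<Lambda>) \<longrightarrow>
        cq_nonneg (moore_dyson_det m (\<lambda>i j. K (x i) (x j))))"

definition orthonormal_family ::
  "'a measure \<Rightarrow> 'i set \<Rightarrow> ('i \<Rightarrow> 'a \<Rightarrow> cquat) \<Rightarrow> bool" where
  "orthonormal_family \<mu> J u \<longleftrightarrow>
     (\<forall>k\<in>J. cq_measurable \<mu> (u k)) \<and>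
     (\<forall>k\<in>J. \<forall>l\<in>J. cq_has_integral \<mu> (\<lambda>x. cq_conj (u k x) * u l x) (if k = l then 1 else 0))"

text \<open>Finite diagonal forms only: the kernels concerned have finite rank.\<close>

definition diagonal_form ::
  "'a measure \<Rightarrow> 'i set \<Rightarrow> ('i \<Rightarrow> complex) \<Rightarrow> ('i \<Rightarrow> 'a \<Rightarrow> cquat) \<Rightarrow>
   ('a \<Rightarrow> 'a \<Rightarrow> cquat) \<Rightarrow> bool" where
  "diagonal_form \<mu> J lam u K \<longleftrightarrow>
     finite J \<and> orthonormal_family \<mu> J u \<and>
     (\<forall>x\<in>space \<mu>. \<forall>y\<in>space \<mu>. K x y = (\<Sum>k\<in>J. cq_scalar (lam k) * u k x * cq_conj (u k y)))"

definition quasi_real_form ::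
  "'a measure \<Rightarrow> 'i set \<Rightarrow> ('i \<Rightarrow> real) \<Rightarrow> ('i \<Rightarrow> 'a \<Rightarrow> cquat) \<Rightarrow>
   ('a \<Rightarrow> 'a \<Rightarrow> cquat) \<Rightarrow> bool" where
  "quasi_real_form \<mu> J lam u K \<longleftrightarrow> diagonal_form \<mu> J (\<lambda>k. complex_of_real (lam k)) u K"

text \<open>Complete positivity of a kernel only involves the eigenfunctions of its diagonal form.\<close>

definition completely_positive ::
  "'a measure \<Rightarrow> 'i set \<Rightarrow> ('i \<Rightarrow> 'a \<Rightarrow> cquat) \<Rightarrow> bool" where
  "completely_positive \<mu> J u \<longleftrightarrow>
     (\<forall>I\<subseteq>J. positive_kernel (space \<mu>) (\<lambda>x y. \<Sum>k\<in>I. u k x * cq_conj (u k y)))"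

end

theory Submission
  imports Defs
begin

text \<open>
  Choose a random set \<open>I\<close> of eigenfunctions, keeping \<open>k\<close> with probability \<open>\<lambda>\<^sub>k\<close> independently, and
  then put \<open>N = |I|\<close> points with density \<open>det K\<^sub>I / N!\<close>. Since \<open>K\<^sub>I\<close> is a projection of trace \<open>N\<close>,
  integrating one variable out of the \<open>n\<close> by \<open>n\<close> determinant gives \<open>N - n + 1\<close> times the smaller one,
  so the correlation functions given \<open>I\<close> are the determinants of \<open>K\<^sub>I\<close>. Averaging over \<open>I\<close> yields the
  determinants of \<open>K\<close> provided these are affine in each eigenvalue separately. For this, and for
  the symmetry of the determinant and its vanishing at coinciding points, the determinant is
  identified with a Pfaffian; changing one eigenvalue adds a decomposable two-form, which squares
  to zero.
\<close>

section \<open>Pfaffians\<close>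

text \<open>The obstacle is that the entries do not commute: in the cycle expansion the order of the
  cycles and the starting point of each are prescribed, so row expansions, symmetry in the indices
  and affine dependence on an eigenvalue cannot be read off. The way out is to cut the leading cycle
  open (\<open>gdet\<close>). The open cycle loses factors only at its left end, so its recursion
  needs no ordering of indices; read on 2 by 2 complex blocks, it is the expansion of a Pfaffian of
  twice the size along its first entry. The open right end serves the integration as well: a
  variable sitting there is integrated out by the reproducing property of the projection. In the
  constant \<open>N - n + 1\<close>, \<open>N\<close> is the trace and \<open>n - 1\<close> counts
  the points that can follow the integrated one in its cycle. Complete positivity enters because the
  density must be nonnegative for every choice of \<open>I\<close>; it also forces the determinants
  with more than \<open>N\<close> points to vanish, since one further integration would turn them
  negative.\<close>

fun contract :: "('v \<Rightarrow> complex) \<Rightarrow> ('v list \<Rightarrow> complex) \<Rightarrow> 'v list \<Rightarrow> complex" where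
  "contract a f [] = 0"
| "contract a f (w # ws) = a w * f ws - contract a (\<lambda>us. f (w # us)) ws"

text \<open>In exterior algebra \<open>contract a f\<close> is the product of the one-form
  \<open>a\<close> with the form \<open>f\<close>. For antisymmetric \<open>A\<close>,
  \<open>pfaffian A n\<close> is then the n-th power of the two-form \<open>A\<close> divided by n
  factorial. The number \<open>n\<close> counts pairs; lists of length other than
  \<open>2 * n\<close> get the value 0.\<close>

primrec pfaffian :: "('v \<Rightarrow> 'v \<Rightarrow> complex) \<Rightarrow> nat \<Rightarrow> 'v list \<Rightarrow> complex" where
  "pfaffian A 0 vs = (if vs = [] then 1 else 0)"
| "pfaffian A (Suc n) vs = (case vs of [] \<Rightarrow> 0 | v # ws \<Rightarrow> contract (A v) (pfaffian A n) ws)"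

lemma contract_add: "contract a (\<lambda>us. f us + g us) vs = contract a f vs + contract a g vs"
  by (induction vs arbitrary: f g) (simp_all add: algebra_simps)

lemma contract_mult: "contract a (\<lambda>us. c * f us) vs = c * contract a f vs"
  by (induction vs arbitrary: f) (simp_all add: algebra_simps)

lemma contract_uminus: "contract a (\<lambda>us. - f us) vs = - contract a f vs"
  by (induction vs arbitrary: f) (simp_all add: algebra_simps)

lemma contract_diff: "contract a (\<lambda>us. f us - g us) vs = contract a f vs - contract a g vs"
  by (induction vs arbitrary: f g) (simp_all add: algebra_simps)

lemma contract_zero: "contract a (\<lambda>us. 0) vs = 0"
  by (induction vs) simp_all

lemma contract_add_left: "contract (\<lambda>v. a v + b v) f vs = contract a f vs + contract b f vs"
  by (induction vs arbitrary: f) (simp_all add: algebra_simps)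

lemma contract_mult_left: "contract (\<lambda>v. c * a v) f vs = c * contract a f vs"
  by (induction vs arbitrary: f) (simp_all add: algebra_simps)

lemma contract_anticommute: "contract a (contract b f) vs = - contract b (contract a f) vs"
proof (induction vs arbitrary: f)
  case Nil
  then show ?case by simp
next
  case (Cons v vs)
  show ?case
    by (simp add: contract_diff contract_mult Cons.IH[of "\<lambda>us. f (v # us)"])
qed

lemma contract_twice: "contract a (contract a f) vs = 0"
  using contract_anticommute[of a a f vs] by simp

section \<open>Alternating functions of lists\<close>

definition alternating :: "('v list \<Rightarrow> complex) \<Rightarrow> bool" where
  "alternating f \<longleftrightarrow> (\<forall>us v w vs. f (us @ v # w # vs) = - f (us @ w # v # vs))"

lemma alternatingD: "alternating f \<Longrightarrow> f (us @ v # w # vs) = - f (us @ w # v # vs)"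
  unfolding alternating_def by blast

lemma alternating_Cons: "alternating f \<Longrightarrow> alternating (\<lambda>us. f (v # us))"
  unfolding alternating_def by (metis append_Cons)

lemma alternating_Cons2: "alternating f \<Longrightarrow> alternating (\<lambda>us. f (v # w # us))"
  by (drule alternating_Cons) (erule alternating_Cons)

lemma alternating_contract:
  assumes "alternating f" shows "alternating (contract a f)"
proof -
  have "contract a f (us @ v # w # vs) = - contract a f (us @ w # v # vs)"
    if "alternating f" for us v w vs and f
    using that
  proof (induction us arbitrary: f)
    case Nil
    have "(\<lambda>us. f (v # w # us)) = (\<lambda>us. - f (w # v # us))"
      using alternatingD[OF Nil, of "[]"] by (intro ext) (metis append_Nil)
    then show ?case by (simp add: contract_uminus)
  next
    case (Cons c us)
    show ?case
      using Cons.IH[OF alternating_Cons[OF Cons.prems, of c]] alternatingD[OF Cons.prems, of us v w vs]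
      by (simp add: algebra_simps)
  qed
  with assms show ?thesis unfolding alternating_def by blast
qed

lemma alternating_pfaffian:
  assumes antisym: "\<And>v w. A v w = - A w v"
  shows "alternating (pfaffian A n)"
proof (induction n)
  case 0
  then show ?case by (simp add: alternating_def)
next
  case (Suc n)
  \<comment> \<open>Swaps behind the first entry are covered by \<open>alternating_contract\<close>.
    For the first two entries the expansion is applied twice, and the contractions with
    \<open>A v\<close> and \<open>A w\<close> anticommute.\<close>
  have head: "pfaffian A (Suc n) (v # w # vs) = - pfaffian A (Suc n) (w # v # vs)" for v w vs
  proof (cases n)
    case 0
    then show ?thesis using antisym[of v w] by (auto simp: contract_zero)
  next
    case (Suc m)
    then show ?thesis
      using antisym[of v w] contract_anticommute[of "A v" "A w" "pfaffian A m" vs] by simp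
  qed
  have "pfaffian A (Suc n) (us @ v # w # vs) = - pfaffian A (Suc n) (us @ w # v # vs)" for us v w vs
  proof (cases us)
    case Nil
    then show ?thesis using head by simp
  next
    case (Cons c us')
    then show ?thesis using alternatingD[OF alternating_contract[OF Suc.IH], of "A c" us' v w vs] by simp
  qed
  then show ?case unfolding alternating_def by blast
qed

lemma contract_map: "contract a f (map h vs) = contract (\<lambda>v. a (h v)) (\<lambda>us. f (map h us)) vs"
  by (induction vs arbitrary: f) simp_all

lemma pfaffian_map: "pfaffian A n (map h vs) = pfaffian (\<lambda>v w. A (h v) (h w)) n vs"
proof (induction n arbitrary: vs)
  case 0
  then show ?case by simp
next
  case (Suc n)
  then show ?case by (cases vs) (simp_all add: contract_map)
qed

text \<open>The two-form \<open>\<alpha> \<and> \<beta>\<close> squares to zero, so the divided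
  power of \<open>A + t * (\<alpha> \<and> \<beta>)\<close> stops at first order in
  \<open>t\<close>, with coefficient \<open>\<alpha> \<and> \<beta>\<close> times the next lower
  divided power of \<open>A\<close>.\<close>

lemma pfaffian_add_decomposable:
  fixes A :: "'v \<Rightarrow> 'v \<Rightarrow> complex" and \<alpha> \<beta> :: "'v \<Rightarrow> complex" and t :: complex
  defines "B \<equiv> \<lambda>v w. A v w + t * (\<alpha> v * \<beta> w - \<alpha> w * \<beta> v)"
  shows "pfaffian B (Suc n) vs =
    pfaffian A (Suc n) vs + t * contract \<alpha> (contract \<beta> (pfaffian A n)) vs"
proof (induction n arbitrary: vs)
  case 0
  show ?case
  proof (cases vs)
    case (Cons v ws)
    have B: "B v = (\<lambda>w. A v w + (t * \<alpha> v * \<beta> w + (- t * \<beta> v) * \<alpha> w))"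
      unfolding B_def by (auto simp: algebra_simps)
    define f where "f = (pfaffian A 0 :: 'v list \<Rightarrow> complex)"
    have f: "f (u # us) = 0" "pfaffian B 0 = f" "pfaffian A 0 = f" for u us
      unfolding f_def by auto
    show ?thesis
      unfolding Cons B pfaffian.simps(2) list.case f contract_add_left contract_mult_left
      by (simp add: contract_diff contract_mult contract_zero f algebra_simps)
  qed simp
next
  case (Suc n)
  show ?case
  proof (cases vs)
    case (Cons v ws)
    define C where "C = contract \<alpha> (contract \<beta> (pfaffian A n))"
    have B: "B v = (\<lambda>w. A v w + (t * \<alpha> v * \<beta> w + (- t * \<beta> v) * \<alpha> w))"
      unfolding B_def by (auto simp: algebra_simps)
    have IH: "pfaffian B (Suc n) = (\<lambda>us. pfaffian A (Suc n) us + t * C us)"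
      using Suc.IH unfolding C_def by blast
    \<comment> \<open>\<open>C\<close> already contains both one-forms, so a further factor
      \<open>\<alpha>\<close> or \<open>\<beta>\<close> kills it. These two facts remove the terms
      quadratic in \<open>t\<close>.\<close>
    have 1: "contract \<alpha> C us = 0" for us
      unfolding C_def by (rule contract_twice)
    have "C = (\<lambda>us. - contract \<beta> (contract \<alpha> (pfaffian A n)) us)"
      unfolding C_def using contract_anticommute by blast
    then have 2: "contract \<beta> C us = 0" for us
      using contract_twice by (simp add: contract_uminus)
    \<comment> \<open>The one-form \<open>A v\<close> moves past two one-forms, and the two signs
      cancel.\<close>
    have 3: "contract \<alpha> (contract \<beta> (contract (A v) (pfaffian A n))) ws = contract (A v) C ws"
    proof -
      have "contract \<beta> (contract (A v) (pfaffian A n)) =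
          (\<lambda>us. - contract (A v) (contract \<beta> (pfaffian A n)) us)"
        using contract_anticommute by blast
      then show ?thesis
        using contract_anticommute[of \<alpha> "A v"] by (simp add: contract_uminus C_def)
    qed
    define P where "P = pfaffian A (Suc n)"
    have P: "P (v # us) = contract (A v) (pfaffian A n) us" for us
      unfolding P_def by simp
    have PA: "pfaffian A (Suc (Suc n)) (v # ws) = contract (A v) P ws"
      unfolding P_def by (simp only: pfaffian.simps(2) list.case)
    have "pfaffian B (Suc (Suc n)) vs = contract (B v) (pfaffian B (Suc n)) ws"
      unfolding Cons by (simp only: pfaffian.simps(2)[of _ "Suc n"] list.case)
    also have "\<dots> = contract (A v) P ws + t * contract (A v) C ws +
       t * (\<alpha> v * contract \<beta> P ws - \<beta> v * contract \<alpha> P ws)"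
      unfolding IH B contract_add_left contract_mult_left contract_add contract_mult 1 2 P_def[symmetric]
      by (simp add: algebra_simps)
    also have "\<dots> = pfaffian A (Suc (Suc n)) vs + t * contract \<alpha> (contract \<beta> P) vs"
      unfolding Cons PA contract.simps P contract_diff contract_mult 3
      by (simp add: right_diff_distrib)
    also have "P = pfaffian A (Suc n)"
      by (rule P_def)
    finally show ?thesis .
  qed simp
qed

lemma pfaffian_affine:
  "\<exists>a b. \<forall>t. pfaffian (\<lambda>v w. A v w + t * (\<alpha> v * \<beta> w - \<alpha> w * \<beta> v)) n vs = a + t * b"
proof (cases n)
  case 0
  then have "\<forall>t. pfaffian (\<lambda>v w. A v w + t * (\<alpha> v * \<beta> w - \<alpha> w * \<beta> v)) n vs =
      pfaffian A 0 vs + t * 0"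
    by simp
  then show ?thesis by blast
next
  case (Suc m)
  show ?thesis
    unfolding Suc by (intro exI allI) (rule pfaffian_add_decomposable)
qed

section \<open>Lists in which each index contributes an adjacent pair\<close>

fun doubled :: "'i list \<Rightarrow> ('i \<times> bool) list" where
  "doubled [] = []"
| "doubled (i # is) = (i, True) # (i, False) # doubled is"

lemma alternating_rotate:
  assumes "alternating f"
  shows "f (a # b # c # us) = f (c # a # b # us)"
  using alternatingD[OF assms, of "[a]" b c us] alternatingD[OF assms, of "[]" a c "b # us"] by simp

text \<open>A single entry moves past a complete pair without a sign. Hence the sign of a term
  depends only on whether the removed entry is first or second in its own pair, and its partner can
  be brought to the front for free.\<close>

lemma contract_doubled:
  assumes "alternating f" "distinct L"
  shows "contract a f (doubled L) = (\<Sum>j\<in>set L.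
    a (j, True) * f ((j, False) # doubled (remove1 j L)) -
    a (j, False) * f ((j, True) # doubled (remove1 j L)))"
  using assms
proof (induction L arbitrary: f)
  case Nil
  then show ?case by simp
next
  case (Cons x L)
  let ?g = "\<lambda>us. f ((x, True) # (x, False) # us)"
  have g: "alternating ?g"
    using Cons.prems by (simp add: alternating_Cons2)
  have rot: "?g (v # us) = f (v # (x, True) # (x, False) # us)" for v us
    by (rule alternating_rotate[OF Cons.prems(1)])
  have rem: "remove1 j (x # L) = x # remove1 j L" if "j \<in> set L" for j
    using that Cons.prems by auto
  have "contract a ?g (doubled L) = (\<Sum>j\<in>set L.
    a (j, True) * f ((j, False) # doubled (remove1 j (x # L))) -
    a (j, False) * f ((j, True) # doubled (remove1 j (x # L))))"
    using Cons.IH[OF g] Cons.prems by (intro trans[OF Cons.IH[OF g]] sum.cong) (auto simp: rem rot)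
  then show ?case using Cons.prems by simp
qed

lemma alternating_doubled_remove1:
  assumes "alternating f" "j \<in> set L"
  shows "f (doubled L) = f (doubled (j # remove1 j L))"
  using assms
proof (induction L arbitrary: f)
  case (Cons x L)
  let ?g = "\<lambda>us. f ((x, True) # (x, False) # us)"
  have g: "alternating ?g"
    using Cons.prems by (simp add: alternating_Cons2)
  show ?case
  proof (cases "j = x")
    case False
    then have "f (doubled (x # L)) = ?g ((j, True) # (j, False) # doubled (remove1 j L))"
      using Cons.IH[OF g] Cons.prems by simp
    also have "\<dots> = f ((j, True) # (x, True) # (x, False) # (j, False) # doubled (remove1 j L))"
      by (rule alternating_rotate[OF Cons.prems(1)])
    also have "\<dots> = f ((j, True) # (j, False) # (x, True) # (x, False) # doubled (remove1 j L))"
      by (rule alternating_rotate[OF alternating_Cons[OF Cons.prems(1)]])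
    finally show ?thesis using False by simp
  qed simp
qed simp

text \<open>Whole pairs pass each other by even permutations, so the order of the indices is
  immaterial. This is the source of the symmetry of the determinant.\<close>

lemma alternating_doubled_mset:
  assumes "alternating f" "mset L = mset L'"
  shows "f (doubled L) = f (doubled L')"
  using assms
proof (induction L arbitrary: f L')
  case (Cons x L)
  let ?g = "\<lambda>us. f ((x, True) # (x, False) # us)"
  have g: "alternating ?g"
    using Cons.prems by (simp add: alternating_Cons2)
  have x: "x \<in> set L'"
    using Cons.prems(2) by (metis list.set_intros(1) set_mset_mset)
  have "mset L = mset (remove1 x L')"
    using Cons.prems(2) by (metis mset_remove1 remove1.simps(2))
  then have "?g (doubled L) = ?g (doubled (remove1 x L'))"
    by (rule Cons.IH[OF g])
  then show ?case using alternating_doubled_remove1[OF Cons.prems(1) x] by simp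
qed simp

section \<open>Expansion of the Moore-Dyson determinant along a cycle\<close>

definition leaders :: "nat set \<Rightarrow> (nat \<Rightarrow> nat) \<Rightarrow> nat set" where
  "leaders S \<sigma> = {a \<in> S. \<forall>b \<in> orbit \<sigma> a. b \<le> a}"

definition cycle_products :: "(nat \<Rightarrow> nat \<Rightarrow> cquat) \<Rightarrow> (nat \<Rightarrow> nat) \<Rightarrow> nat set \<Rightarrow> cquat" where
  "cycle_products X \<sigma> L = prod_list (map (cycle_product X \<sigma>) (rev (sorted_list_of_set L)))"

text \<open>The recursion deletes arbitrary indices, so determinants over index sets other than
  initial segments are needed.\<close>

definition mdet :: "(nat \<Rightarrow> nat \<Rightarrow> cquat) \<Rightarrow> nat set \<Rightarrow> cquat" where
  "mdet X S = (\<Sum>\<sigma> | \<sigma> permutes S.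
     (-1) ^ (card S - card (leaders S \<sigma>)) * cycle_products X \<sigma> (leaders S \<sigma>))"

definition open_cycle :: "(nat \<Rightarrow> nat \<Rightarrow> cquat) \<Rightarrow> (nat \<Rightarrow> nat) \<Rightarrow> nat \<Rightarrow> nat \<Rightarrow> cquat" where
  "open_cycle X \<sigma> a b =
     prod_list (map (\<lambda>t. X ((\<sigma> ^^ t) a) ((\<sigma> ^^ Suc t) a)) [0..<card (orbit \<sigma> a) - 1]) *
     X ((\<sigma> ^^ (card (orbit \<sigma> a) - 1)) a) b"

text \<open>The part of the determinant over \<open>insert a S\<close> in which the cycle through \<open>a\<close> is written
  first and its last factor points to \<open>b\<close> instead of back to \<open>a\<close>.\<close>

definition gdet :: "(nat \<Rightarrow> nat \<Rightarrow> cquat) \<Rightarrow> nat set \<Rightarrow> nat \<Rightarrow> nat \<Rightarrow> cquat" where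
  "gdet X S a b = (\<Sum>\<sigma> | \<sigma> permutes insert a S.
     (-1) ^ (card S - card (leaders (S - orbit \<sigma> a) \<sigma>)) *
     (open_cycle X \<sigma> a b * cycle_products X \<sigma> (leaders (S - orbit \<sigma> a) \<sigma>)))"

lemma moore_dyson_det_eq_mdet: "moore_dyson_det n X = mdet X {..<n}"
  unfolding moore_dyson_det_def mdet_def cycle_products_def cycle_leaders_def leaders_def by simp

lemma mdet_empty: "mdet X {} = 1"
  by (simp add: mdet_def cycle_products_def leaders_def)

section \<open>Orbits of permutations, and splicing a new point into a cycle\<close>

lemma card_orbit_eq_funpow_dist1:
  assumes "x \<in> orbit f x" shows "card (orbit f x) = funpow_dist1 f x x"
  using orbit_conv_funpow_dist1[OF assms] inj_on_funpow_dist1[OF assms]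
  by (metis card_atLeastLessThan card_image diff_zero)

lemma card_orbit_eqI:
  assumes "(f ^^ n) x = x" "0 < n" "\<And>t. 0 < t \<Longrightarrow> t < n \<Longrightarrow> (f ^^ t) x \<noteq> x"
  shows "card (orbit f x) = n"
proof -
  have x: "x \<in> orbit f x"
    unfolding orbit_altdef using assms by force
  have "(f ^^ funpow_dist1 f x x) x = x"
    by (rule funpow_dist1_prop[OF x])
  then have "n \<le> funpow_dist1 f x x"
    using assms(3) by (metis not_le zero_less_Suc)
  moreover have "funpow_dist1 f x x \<le> n"
    using funpow_dist1_least[of n f x x] assms by force
  ultimately show ?thesis using card_orbit_eq_funpow_dist1[OF x] by simp
qed

context
  fixes p :: "nat \<Rightarrow> nat" and S :: "nat set"
  assumes p: "p permutes S" and S: "finite S"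
begin

lemma permutation_permutes_p: "permutation p"
  using p S permutation_permutes by blast

lemma self_in_orbit: "x \<in> orbit p x"
  by (rule permutation_self_in_orbit[OF permutation_permutes_p])

lemma funpow_card_orbit: "(p ^^ card (orbit p x)) x = x"
  using card_orbit_eq_funpow_dist1[OF self_in_orbit] funpow_dist1_prop[OF self_in_orbit] by metis

lemma funpow_less_card_orbit: "0 < t \<Longrightarrow> t < card (orbit p x) \<Longrightarrow> (p ^^ t) x \<noteq> x"
  using card_orbit_eq_funpow_dist1[OF self_in_orbit] funpow_dist1_least by metis

lemma finite_orbit_permutes: "finite (orbit p x)"
  by (rule finite_orbit[OF self_in_orbit])

lemma card_orbit_pos: "0 < card (orbit p x)"
  using finite_orbit_permutes self_in_orbit card_gt_0_iff by blast

lemma orbit_eq_funpow_less: "orbit p x = (\<lambda>t. (p ^^ t) x) ` {..<card (orbit p x)}"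
  using orbit_conv_funpow_dist1[OF self_in_orbit] card_orbit_eq_funpow_dist1[OF self_in_orbit]
  by (metis atLeast0LessThan)

lemma orbit_eq_of_mem: "y \<in> orbit p x \<Longrightarrow> orbit p y = orbit p x"
  by (rule orbit_cyclic_eq3[OF cyclic_on_orbit[OF p S]])

lemma funpow_notin_orbit: "x \<notin> orbit p j \<Longrightarrow> (p ^^ t) x \<notin> orbit p j"
  by (metis funpow_in_orbit orbit_eq_of_mem self_in_orbit)

lemma funpow_ne_outside: "a \<notin> S \<Longrightarrow> x \<noteq> a \<Longrightarrow> (p ^^ t) x \<noteq> a"
proof (induction t)
  case (Suc t)
  then show ?case using permutes_inj[OF p] permutes_not_in[OF p]
    by (metis funpow.simps(2) comp_apply injD)
qed simp

lemma orbit_subset_carrier: "j \<in> S \<Longrightarrow> orbit p j \<subseteq> S"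
  by (rule permutes_orbit_subset[OF p])

lemma orbit_outside: "a \<notin> S \<Longrightarrow> orbit p a = {a}"
  by (simp add: orbit_eq_singleton_iff permutes_not_in[OF p])

context
  fixes a j :: nat and \<sigma> :: "nat \<Rightarrow> nat"
  assumes a: "a \<notin> S" and j: "j \<in> S" and \<sigma>: "\<sigma> = Transposition.transpose a j \<circ> p"
begin

text \<open>As \<open>p\<close> fixes \<open>a\<close>, the transposition inserts \<open>a\<close>
  into the cycle of \<open>j\<close> immediately before \<open>j\<close>: \<open>a\<close> goes to
  \<open>j\<close>, then the old cycle is followed, and the old predecessor of \<open>j\<close> goes
  to \<open>a\<close>.\<close>

lemma funpow_splice: "t < card (orbit p j) \<Longrightarrow> (\<sigma> ^^ Suc t) a = (p ^^ t) j"
proof (induction t)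
  case 0
  then show ?case by (simp add: \<sigma> permutes_not_in[OF p a])
next
  case (Suc t)
  then have "(\<sigma> ^^ Suc (Suc t)) a = \<sigma> ((p ^^ t) j)" by simp
  also have "\<dots> = Transposition.transpose a j ((p ^^ Suc t) j)" by (simp add: \<sigma>)
  also have "\<dots> = (p ^^ Suc t) j"
    using funpow_less_card_orbit[of "Suc t" j] Suc.prems funpow_ne_outside[OF a, of j "Suc t"] a j
    by (intro transpose_apply_other) auto
  finally show ?case .
qed

lemma funpow_splice_close: "(\<sigma> ^^ Suc (card (orbit p j))) a = a"
proof -
  obtain c where c: "card (orbit p j) = Suc c"
    using card_orbit_pos[of j] gr0_implies_Suc by blast
  have "(\<sigma> ^^ Suc (Suc c)) a = \<sigma> ((p ^^ c) j)"
    using funpow_splice[of c] c by simp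
  also have "\<dots> = Transposition.transpose a j ((p ^^ Suc c) j)" by (simp add: \<sigma>)
  also have "\<dots> = a" using funpow_card_orbit[of j] c by simp
  finally show ?thesis using c by simp
qed

lemma card_orbit_splice: "card (orbit \<sigma> a) = Suc (card (orbit p j))"
proof (rule card_orbit_eqI[OF funpow_splice_close])
  fix t :: nat assume "0 < t" "t < Suc (card (orbit p j))"
  then obtain s where "t = Suc s" "s < card (orbit p j)" by (cases t) auto
  then show "(\<sigma> ^^ t) a \<noteq> a"
    using funpow_splice[of s] funpow_ne_outside[OF a, of j s] a j by metis
qed simp

lemma orbit_splice: "orbit \<sigma> a = insert a (orbit p j)"
proof -
  have "orbit \<sigma> a = {(\<sigma> ^^ m) a |m. m < Suc (card (orbit p j))}"
    by (rule orbit_altdef_bounded[OF funpow_splice_close]) simp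
  also have "\<dots> = insert a ((\<lambda>t. (\<sigma> ^^ Suc t) a) ` {..<card (orbit p j)})"
    unfolding setcompr_eq_image by (auto simp: less_Suc_eq_0_disj image_def simp del: funpow.simps)
  also have "(\<lambda>t. (\<sigma> ^^ Suc t) a) ` {..<card (orbit p j)} = (\<lambda>t. (p ^^ t) j) ` {..<card (orbit p j)}"
    using funpow_splice by (intro image_cong) auto
  also have "\<dots> = orbit p j" by (rule orbit_eq_funpow_less[symmetric])
  finally show ?thesis .
qed

lemma funpow_splice_other:
  assumes "x \<notin> orbit p j" "x \<noteq> a"
  shows "(\<sigma> ^^ t) x = (p ^^ t) x"
proof (induction t)
  case (Suc t)
  have "(\<sigma> ^^ Suc t) x = \<sigma> ((p ^^ t) x)"
    using Suc by simp
  also have "\<dots> = Transposition.transpose a j ((p ^^ Suc t) x)"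
    by (simp add: \<sigma>)
  also have "\<dots> = (p ^^ Suc t) x"
    using funpow_ne_outside[OF a assms(2), of "Suc t"] funpow_notin_orbit[OF assms(1), of "Suc t"]
      self_in_orbit[of j]
    by (intro transpose_apply_other) auto
  finally show ?case .
qed simp

lemma orbit_splice_other:
  assumes "x \<notin> orbit p j" "x \<noteq> a"
  shows "orbit \<sigma> x = orbit p x"
  using funpow_splice_other[OF assms] unfolding orbit_altdef[of \<sigma> x] orbit_altdef[of p x] by metis

lemma leaders_splice: "leaders (S - orbit \<sigma> a) \<sigma> = leaders (S - orbit p j) p"
  using a j orbit_splice_other unfolding leaders_def orbit_splice by auto

lemma cycle_product_splice:
  "x \<notin> orbit p j \<Longrightarrow> x \<noteq> a \<Longrightarrow> cycle_product X \<sigma> x = cycle_product X p x"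
  unfolding cycle_product_def
  by (simp add: funpow_splice_other orbit_splice_other del: funpow.simps)

lemma cycle_products_splice:
  "cycle_products X \<sigma> (leaders (S - orbit \<sigma> a) \<sigma>) = cycle_products X p (leaders (S - orbit p j) p)"
proof -
  have "finite (leaders (S - orbit p j) p)"
    using S by (simp add: leaders_def)
  then show ?thesis
    unfolding leaders_splice cycle_products_def
    using a by (intro arg_cong[of _ _ prod_list] map_cong refl cycle_product_splice)
      (auto simp: leaders_def)
qed

lemma open_cycle_splice: "open_cycle X \<sigma> a b = X a j * open_cycle X p j b"
proof -
  obtain c where c: "card (orbit p j) = Suc c"
    using card_orbit_pos[of j] gr0_implies_Suc by blast
  have eq: "(\<sigma> ^^ Suc t) a = (p ^^ t) j" if "t < Suc c" for t
    using funpow_splice that c by simp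
  have "[0..<Suc c] = 0 # map Suc [0..<c]"
    by (simp add: map_Suc_upt upt_conv_Cons del: upt_Suc)
  then have "map (\<lambda>t. X ((\<sigma> ^^ t) a) ((\<sigma> ^^ Suc t) a)) [0..<Suc c] =
      X a j # map (\<lambda>t. X ((p ^^ t) j) ((p ^^ Suc t) j)) [0..<c]"
    using eq[of 0] by (simp add: eq o_def del: funpow.simps)
  then show ?thesis
    unfolding open_cycle_def card_orbit_splice c using eq[of c]
    by (simp add: mult.assoc del: funpow.simps upt_Suc)
qed

end

end

text \<open>The exponent of the sign is a truncated difference of cardinalities; this bound ensures
  that it really drops by one when an index is removed.\<close>

lemma card_leaders_less:
  assumes "p permutes S" "finite S" "j \<in> S"
  shows "card (leaders (S - orbit p j) p) < card S"
proof -
  have "leaders (S - orbit p j) p \<subseteq> S - {j}"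
    using self_in_orbit[OF assms(1,2), of j] by (auto simp: leaders_def)
  then show ?thesis
    using assms by (meson card_Diff1_less card_mono finite_Diff le_less_trans)
qed

text \<open>Sort the permutations by the image of \<open>a\<close>. If \<open>a\<close> is fixed,
  its open cycle is the single factor \<open>X a b\<close>, and a full determinant remains. If
  \<open>a\<close> goes to \<open>j\<close>, then \<open>X a j\<close> splits off on the left, what
  remains is a cycle opened at \<open>j\<close> with the same end \<open>b\<close>, and the exponent
  of the sign falls by one. No two entries of \<open>X\<close> ever have to be interchanged.\<close>

lemma gdet_rec:
  assumes S: "finite S" and a: "a \<notin> S"
  shows "gdet X S a b = X a b * mdet X S - (\<Sum>j\<in>S. X a j * gdet X (S - {j}) j b)"
proof -
  let ?F = "\<lambda>\<sigma>. (-1) ^ (card S - card (leaders (S - orbit \<sigma> a) \<sigma>)) *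
     (open_cycle X \<sigma> a b * cycle_products X \<sigma> (leaders (S - orbit \<sigma> a) \<sigma>))"
  let ?P = "{p. p permutes S}"
  have inj: "inj_on (\<lambda>(j, p). Transposition.transpose a j \<circ> p) (insert a S \<times> ?P)"
  proof (rule inj_onI, clarify)
    fix j p j' p'
    assume p: "p permutes S" "p' permutes S" and eq: "Transposition.transpose a j \<circ> p = Transposition.transpose a j' \<circ> p'"
    have "p a = a" "p' a = a" using p a permutes_not_in by metis+
    then have j: "j = j'" using fun_cong[OF eq, of a] by simp
    have "p x = p' x" for x
      using fun_cong[OF eq, of x] j by (auto dest: transpose_eq_imp_eq)
    then have "p = p'" by blast
    with j show "j = j' \<and> p = p'" by simp
  qed
  have "gdet X S a b = (\<Sum>\<sigma>\<in>(\<lambda>(j, p). Transposition.transpose a j \<circ> p) ` (insert a S \<times> ?P). ?F \<sigma>)"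
    unfolding gdet_def permutes_insert by (rule sum.cong) auto
  also have "\<dots> = (\<Sum>(j, p)\<in>insert a S \<times> ?P. ?F (Transposition.transpose a j \<circ> p))"
    by (subst sum.reindex[OF inj]) (auto intro!: sum.cong)
  also have "\<dots> = (\<Sum>j\<in>insert a S. \<Sum>p\<in>?P. ?F (Transposition.transpose a j \<circ> p))"
    using S finite_permutations by (subst sum.cartesian_product[symmetric]) auto
  also have "\<dots> = (\<Sum>p\<in>?P. ?F p) + (\<Sum>j\<in>S. \<Sum>p\<in>?P. ?F (Transposition.transpose a j \<circ> p))"
    using S a by simp
  also have "(\<Sum>p\<in>?P. ?F p) = X a b * mdet X S"
    unfolding mdet_def sum_distrib_left
  proof (rule sum.cong, goal_cases)
    case (2 p)
    then have p: "p permutes S" by simp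
    have 1: "orbit p a = {a}" by (rule orbit_outside[OF p S a])
    have 2: "S - {a} = S" using a by simp
    have "open_cycle X p a b = X a b" by (simp add: open_cycle_def 1)
    moreover have "(-1) ^ k * (x * y) = x * ((-1) ^ k * y)" for k :: nat and x y :: cquat
      by (cases "even k") auto
    ultimately show ?case unfolding 1 2 by simp
  qed simp
  also have "(\<Sum>j\<in>S. \<Sum>p\<in>?P. ?F (Transposition.transpose a j \<circ> p)) = (\<Sum>j\<in>S. - (X a j * gdet X (S - {j}) j b))"
  proof (intro sum.cong refl)
    fix j assume j: "j \<in> S"
    then have ins: "insert j (S - {j}) = S" by auto
    show "(\<Sum>p\<in>?P. ?F (Transposition.transpose a j \<circ> p)) = - (X a j * gdet X (S - {j}) j b)"
      unfolding gdet_def ins sum_distrib_left sum_negf[symmetric]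
    proof (intro sum.cong refl)
      fix p assume "p \<in> ?P"
      then have p: "p permutes S" by simp
      note splice = p S a j refl
      have 1: "S - {j} - orbit p j = S - orbit p j"
        using self_in_orbit[OF p S, of j] by auto
      let ?k = "card (leaders (S - orbit p j) p)"
      have k: "card S - ?k = Suc (card (S - {j}) - ?k)"
        using card_leaders_less[OF p S j] S j by simp
      have "(-1) ^ Suc k * ((x * y) * z) = - (x * ((-1) ^ k * (y * z)))"
        for k :: nat and x y z :: cquat
        by (cases "even k") (auto simp: mult.assoc)
      then show "?F (Transposition.transpose a j \<circ> p) = - (X a j * ((-1) ^ (card (S - {j}) -
          card (leaders (S - {j} - orbit p j) p)) * (open_cycle X p j b *
          cycle_products X p (leaders (S - {j} - orbit p j) p))))"
        unfolding 1 leaders_splice[OF splice]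
          cycle_products_splice[OF splice, unfolded leaders_splice[OF splice]]
          open_cycle_splice[OF splice] k by blast
    qed
  qed
  finally show ?thesis by (simp add: sum_negf)
qed

text \<open>The largest index leads its cycle, and this cycle comes first in the decreasing order,
  which is the arrangement in \<open>gdet\<close>. The exponents agree because the extra index and
  the extra leader cancel.\<close>

lemma mdet_insert_max:
  assumes S: "finite S" and n: "\<And>i. i \<in> S \<Longrightarrow> i < n"
  shows "mdet X (insert n S) = gdet X S n n"
  unfolding mdet_def gdet_def
proof (intro sum.cong refl)
  fix \<sigma> assume "\<sigma> \<in> {\<sigma>. \<sigma> permutes insert n S}"
  then have \<sigma>: "\<sigma> permutes insert n S" by simp
  have fin: "finite (insert n S)" using S by simp
  note o = \<sigma> fin
  let ?L = "leaders (S - orbit \<sigma> n) \<sigma>"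
  have finL: "finite ?L" and nL: "\<And>i. i \<in> ?L \<Longrightarrow> i < n"
    using S n by (auto simp: leaders_def)
  have orb: "orbit \<sigma> n \<subseteq> insert n S" by (rule orbit_subset_carrier[OF o]) simp
  have L: "leaders (insert n S) \<sigma> = insert n ?L"
  proof (rule set_eqI)
    fix i
    have "n \<in> leaders (insert n S) \<sigma>"
      using orb n by (fastforce simp: leaders_def)
    moreover have "i \<notin> leaders (insert n S) \<sigma>" if "i \<in> S" "i \<in> orbit \<sigma> n"
    proof -
      have "n \<in> orbit \<sigma> i" using orbit_eq_of_mem[OF o that(2)] self_in_orbit[OF o] by simp
      then show ?thesis using n[OF that(1)] by (force simp: leaders_def)
    qed
    ultimately show "i \<in> leaders (insert n S) \<sigma> \<longleftrightarrow> i \<in> insert n ?L"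
      by (auto simp: leaders_def)
  qed
  have nS: "n \<notin> S" "n \<notin> ?L" using n nL by blast+
  have "sorted_list_of_set (insert n ?L) = sorted_list_of_set ?L @ [n]"
    using finL nL nS by (simp add: sorted_insort_is_snoc less_imp_le)
  then have prods: "cycle_products X \<sigma> (insert n ?L) = cycle_product X \<sigma> n * cycle_products X \<sigma> ?L"
    by (simp add: cycle_products_def)
  obtain c where c: "card (orbit \<sigma> n) = Suc c"
    using card_orbit_pos[OF o, of n] gr0_implies_Suc by blast
  have cyc: "cycle_product X \<sigma> n = open_cycle X \<sigma> n n"
    using funpow_card_orbit[OF o, of n] by (simp add: cycle_product_def open_cycle_def c)
  show "(-1) ^ (card (insert n S) - card (leaders (insert n S) \<sigma>)) *
      cycle_products X \<sigma> (leaders (insert n S) \<sigma>) =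
    (-1) ^ (card S - card ?L) * (open_cycle X \<sigma> n n * cycle_products X \<sigma> ?L)"
    unfolding L prods cyc using S finL nS by (simp add: mult.assoc)
qed

section \<open>The determinant of a self-dual matrix as a Pfaffian\<close>

lemmas cquat_defs = zero_cquat_def one_cquat_def plus_cquat_def minus_cquat_def
  uminus_cquat_def times_cquat_def cq_scalar_def cq_conj_def

lemma cq_scalar_commute: "q * cq_scalar c = cq_scalar c * q"
  by (simp add: cquat_defs)

lemma cq_scalar_add: "cq_scalar (a + b) = cq_scalar a + cq_scalar b"
  by (simp add: cquat_defs)

lemma cq_scalar_0: "cq_scalar 0 = 0"
  by (simp add: cquat_defs)

lemma cq_scalar_1: "cq_scalar 1 = 1"
  by (simp add: cquat_defs)

lemma cq_scalar_inj: "cq_scalar a = cq_scalar b \<longleftrightarrow> a = b"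
  by (simp add: cquat_defs)

lemma cq_conj_add: "cq_conj (p + q) = cq_conj p + cq_conj q"
  by (simp add: cquat_defs)

lemma cq_conj_0: "cq_conj 0 = 0"
  by (simp add: cquat_defs)

lemma cq_conj_sum: "cq_conj (sum f A) = (\<Sum>x\<in>A. cq_conj (f x))"
  by (induction A rule: infinite_finite_induct) (simp_all add: cq_conj_0 cq_conj_add)

lemma cq_conj_mult: "cq_conj (p * q) = cq_conj q * cq_conj p"
  by (simp add: cquat_defs algebra_simps)

lemma cq_conj_scalar: "cq_conj (cq_scalar c) = cq_scalar c"
  by (simp add: cquat_defs)

lemma cq_conj_conj: "cq_conj (cq_conj q) = q"
  by (simp add: cquat_defs)

text \<open>\<open>entry q\<close> is the matrix product of the usual 2 by 2 complex matrix of \<open>q\<close> with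
  [[0, 1], [-1, 0]]. This twist turns self-dual quaternion matrices into antisymmetric
  complex ones.\<close>

definition entry :: "cquat \<Rightarrow> bool \<Rightarrow> bool \<Rightarrow> complex" where
  "entry q \<alpha> \<beta> =
     (if \<alpha> then if \<beta> then - (cq_y q + \<i> * cq_z q) else cq_s q + \<i> * cq_x q
      else if \<beta> then - (cq_s q - \<i> * cq_x q) else - cq_y q + \<i> * cq_z q)"

lemma entry_0: "entry 0 \<alpha> \<beta> = 0"
  by (simp add: entry_def cquat_defs)

lemma entry_add: "entry (p + q) \<alpha> \<beta> = entry p \<alpha> \<beta> + entry q \<alpha> \<beta>"
  by (simp add: entry_def cquat_defs algebra_simps)

lemma entry_diff: "entry (p - q) \<alpha> \<beta> = entry p \<alpha> \<beta> - entry q \<alpha> \<beta>"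
  by (simp add: entry_def cquat_defs algebra_simps)

lemma entry_sum: "entry (sum f A) \<alpha> \<beta> = (\<Sum>x\<in>A. entry (f x) \<alpha> \<beta>)"
  by (induction A rule: infinite_finite_induct) (simp_all add: entry_0 entry_add)

lemma entry_scalar_mult: "entry (cq_scalar c * q) \<alpha> \<beta> = c * entry q \<alpha> \<beta>"
  by (simp add: entry_def cquat_defs algebra_simps)

text \<open>Let \<open>M q\<close> be the complex matrix of \<open>q\<close> and \<open>T\<close>
  the twist. Then \<open>M p M q T\<close> is \<open>(M p T) T^-1 (M q T)\<close>, and the two terms
  come from the two nonzero entries of \<open>T^-1\<close>.\<close>

lemma entry_mult:
  "entry (p * q) \<alpha> \<beta> = entry p \<alpha> False * entry q True \<beta> - entry p \<alpha> True * entry q False \<beta>"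
proof -
  have [simp]: "\<i> * (\<i> * c) = - c" for c
    by (metis i_squared mult.assoc mult_minus1)
  show ?thesis
    by (cases \<alpha>; cases \<beta>) (simp_all add: entry_def cquat_defs algebra_simps)
qed

lemma entry_conj: "entry (cq_conj q) \<alpha> \<beta> = - entry q \<beta> \<alpha>"
  by (simp add: entry_def cquat_defs)

lemma entry_eqI:
  assumes "\<And>\<alpha> \<beta>. entry p \<alpha> \<beta> = entry q \<alpha> \<beta>"
  shows "p = q"
proof -
  have e: "- (cq_y p + \<i> * cq_z p) = - (cq_y q + \<i> * cq_z q)" "- cq_y p + \<i> * cq_z p = - cq_y q + \<i> * cq_z q"
    "cq_s p + \<i> * cq_x p = cq_s q + \<i> * cq_x q" "- (cq_s p - \<i> * cq_x p) = - (cq_s q - \<i> * cq_x q)"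
    using assms[of True True] assms[of False False] assms[of True False] assms[of False True]
    by (simp_all only: entry_def if_True if_False)
  have "2 * cq_y p = 2 * cq_y q" "2 * (\<i> * cq_z p) = 2 * (\<i> * cq_z q)"
    "2 * cq_s p = 2 * cq_s q" "2 * (\<i> * cq_x p) = 2 * (\<i> * cq_x q)"
    using e by algebra+
  then show ?thesis by (intro cquat.expand) simp
qed

text \<open>An antisymmetric 2 by 2 matrix is a multiple of the twist, which is the image of the
  quaternion 1.\<close>

lemma entry_scalar_eqI:
  assumes "\<And>\<alpha> \<beta>. entry q \<alpha> \<beta> = - entry q \<beta> \<alpha>"
  shows "q = cq_scalar (entry q True False)"
proof (rule entry_eqI)
  fix \<alpha> \<beta>
  have "entry q \<alpha> \<alpha> = 0" for \<alpha> using assms[of \<alpha> \<alpha>] by simp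
  moreover have "entry (cq_scalar c) \<alpha> \<beta> = (if \<alpha> = \<beta> then 0 else if \<alpha> then c else - c)" for c
    by (auto simp: entry_def cquat_defs)
  ultimately show "entry q \<alpha> \<beta> = entry (cq_scalar (entry q True False)) \<alpha> \<beta>"
    using assms[of False True] by (cases \<alpha>; cases \<beta>) simp_all
qed

definition form :: "('i \<Rightarrow> 'i \<Rightarrow> cquat) \<Rightarrow> 'i \<times> bool \<Rightarrow> 'i \<times> bool \<Rightarrow> complex" where
  "form X v w = entry (X (fst v) (fst w)) (snd v) (snd w)"

definition pfdet :: "(nat \<Rightarrow> nat \<Rightarrow> cquat) \<Rightarrow> nat set \<Rightarrow> complex" where
  "pfdet X S = pfaffian (form X) (card S) (doubled (sorted_list_of_set S))"

lemma alternating_pfaffian_form: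
  assumes "\<And>i j. X j i = cq_conj (X i j)"
  shows "alternating (pfaffian (form X) n)"
proof (rule alternating_pfaffian)
  fix v w :: "'a \<times> bool"
  show "form X v w = - form X w v"
    unfolding form_def by (subst assms) (simp add: entry_conj)
qed

lemma pfdet_eq_pfaffian:
  assumes X: "\<And>i j. X j i = cq_conj (X i j)" and L: "distinct L" "set L = S"
  shows "pfdet X S = pfaffian (form X) (length L) (doubled L)"
proof -
  have "mset (sorted_list_of_set S) = mset L"
    using L by (metis List.finite_set mset_set_set mset_sorted_list_of_multiset sorted_list_of_mset_set)
  then show ?thesis
    unfolding pfdet_def L(2)[symmetric] distinct_card[OF L(1)]
    using L(2) by (intro alternating_doubled_mset alternating_pfaffian_form X) simp
qed

text \<open>Expanding the Pfaffian along \<open>(a, \<alpha>)\<close> mirrors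
  \<open>gdet_rec\<close>: the partner \<open>(b, \<beta>)\<close> yields the first term, and the
  two copies of each \<open>j\<close> yield a quaternion product in coordinates. The claims are
  proved together because they feed each other: the first term of \<open>gdet_rec\<close> is
  manageable once the determinant over \<open>S\<close> is known to be scalar, and that follows from
  the claim on \<open>gdet\<close> for \<open>S\<close> without its maximum.\<close>

lemma mdet_gdet_pfaffian:
  assumes X: "\<And>i j. X j i = cq_conj (X i j)" and "finite S" "card S = n"
  shows "mdet X S = cq_scalar (pfdet X S) \<and> (\<forall>a b \<alpha> \<beta>. a \<notin> S \<longrightarrow> entry (gdet X S a b) \<alpha> \<beta> =
    pfaffian (form X) (Suc n) ((a, \<alpha>) # (b, \<beta>) # doubled (sorted_list_of_set S)))"
  using assms(2,3)
proof (induction n arbitrary: S)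
  case 0
  then have "S = {}" by simp
  then show ?case
    by (simp add: pfdet_def mdet_empty cq_scalar_1 gdet_rec form_def)
next
  case (Suc n)
  note alt = alternating_pfaffian_form[of X, OF X]
  have mdet: "mdet X S = cq_scalar (pfdet X S)"
  proof -
    define m where "m = Max S"
    have m: "m \<in> S" "\<And>i. i \<in> S - {m} \<Longrightarrow> i < m"
      using Suc.prems unfolding m_def
      by (metis Max_in card_eq_0_iff nat.distinct(2)) (use Suc.prems in \<open>auto simp: less_le\<close>)
    let ?S = "S - {m}"
    have S': "finite ?S" "card ?S = n" "m \<notin> ?S" "insert m ?S = S"
      using Suc.prems m by auto
    have e: "entry (gdet X ?S m m) \<alpha> \<beta> =
        pfaffian (form X) (Suc n) ((m, \<alpha>) # (m, \<beta>) # doubled (sorted_list_of_set ?S))" for \<alpha> \<beta>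
      using Suc.IH[OF S'(1,2)] S'(3) by blast
    \<comment> \<open>With both ends at \<open>m\<close>, exchanging the first two entries of the
      list exchanges \<open>\<alpha>\<close> and \<open>\<beta>\<close>, so the block is
      antisymmetric and hence scalar.\<close>
    have "entry (gdet X ?S m m) \<alpha> \<beta> = - entry (gdet X ?S m m) \<beta> \<alpha>" for \<alpha> \<beta>
      unfolding e using alternatingD[OF alt, of "Suc n" "[]"] by (metis append_Nil)
    then have "gdet X ?S m m = cq_scalar (entry (gdet X ?S m m) True False)"
      by (rule entry_scalar_eqI)
    also have "entry (gdet X ?S m m) True False =
        pfaffian (form X) (Suc n) (doubled (m # sorted_list_of_set ?S))"
      unfolding e by simp
    also have "\<dots> = pfdet X S"
      using S' by (subst pfdet_eq_pfaffian[OF X, of "m # sorted_list_of_set ?S"]) auto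
    also have "gdet X ?S m m = mdet X S"
      using mdet_insert_max[OF S'(1) m(2)] S'(4) by simp
    finally show ?thesis .
  qed
  have "entry (gdet X S a b) \<alpha> \<beta> =
      pfaffian (form X) (Suc (Suc n)) ((a, \<alpha>) # (b, \<beta>) # doubled (sorted_list_of_set S))"
    if a: "a \<notin> S" for a b \<alpha> \<beta>
  proof -
    let ?L = "sorted_list_of_set S" and ?P = "pfaffian (form X) (Suc n)"
    have L: "distinct ?L" "set ?L = S" using Suc.prems by auto
    have IH: "entry (gdet X (S - {j}) j b) \<alpha> \<beta> = ?P ((j, \<alpha>) # (b, \<beta>) # doubled (remove1 j ?L))"
      if "j \<in> S" for j \<alpha> \<beta>
      using Suc.IH[of "S - {j}"] Suc.prems that by (simp add: sorted_list_of_set_remove del: pfaffian.simps)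
    have "entry (gdet X S a b) \<alpha> \<beta> = entry (X a b) \<alpha> \<beta> * pfdet X S -
        (\<Sum>j\<in>S. entry (X a j * gdet X (S - {j}) j b) \<alpha> \<beta>)"
      by (simp add: gdet_rec[OF Suc.prems(1) a] mdet entry_diff entry_sum cq_scalar_commute
        entry_scalar_mult)
    also have "(\<Sum>j\<in>S. entry (X a j * gdet X (S - {j}) j b) \<alpha> \<beta>) = (\<Sum>j\<in>S.
        form X (a, \<alpha>) (j, True) * ?P ((b, \<beta>) # (j, False) # doubled (remove1 j ?L)) -
        form X (a, \<alpha>) (j, False) * ?P ((b, \<beta>) # (j, True) # doubled (remove1 j ?L)))"
    proof (intro sum.cong refl)
      fix j assume j: "j \<in> S"
      \<comment> \<open>In the contraction \<open>(b, \<beta>)\<close> stands before the partner of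
        the removed entry; exchanging the two produces the signs of
        \<open>entry_mult\<close>.\<close>
      have swap: "?P ((b, \<beta>) # (j, \<gamma>) # us) = - ?P ((j, \<gamma>) # (b, \<beta>) # us)" for \<gamma> us
        using alternatingD[OF alt, of "Suc n" "[]"] by (metis append_Nil)
      show "entry (X a j * gdet X (S - {j}) j b) \<alpha> \<beta> =
        form X (a, \<alpha>) (j, True) * ?P ((b, \<beta>) # (j, False) # doubled (remove1 j ?L)) -
        form X (a, \<alpha>) (j, False) * ?P ((b, \<beta>) # (j, True) # doubled (remove1 j ?L))"
        unfolding swap entry_mult IH[OF j] by (simp add: form_def del: pfaffian.simps)
    qed
    also have "\<dots> = contract (form X (a, \<alpha>)) (\<lambda>us. ?P ((b, \<beta>) # us)) (doubled ?L)"
      by (simp only: contract_doubled[OF alternating_Cons[OF alt] L(1)] L(2))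
    also have "pfdet X S = ?P (doubled ?L)"
      unfolding pfdet_def Suc.prems(2) ..
    finally show ?thesis
      unfolding pfaffian.simps(2)[of _ "Suc n"] list.case contract.simps
      by (simp add: form_def[of X "(a, \<alpha>)" "(b, \<beta>)"] del: pfaffian.simps)
  qed
  with mdet show ?case by blast
qed

lemma mdet_eq_pfdet:
  assumes "\<And>i j. X j i = cq_conj (X i j)" and "finite S"
  shows "mdet X S = cq_scalar (pfdet X S)"
  using mdet_gdet_pfaffian[of X, OF assms refl] by blast

text \<open>In the definition of the determinant only the largest index may lead its cycle; for
  self-dual matrices every index may.\<close>

lemma mdet_insert:
  assumes X: "\<And>i j. X j i = cq_conj (X i j)" and S: "finite S" and a: "a \<notin> S"
  shows "mdet X (insert a S) = gdet X S a a"
proof -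
  let ?L = "sorted_list_of_set S" and ?P = "pfaffian (form X) (Suc (card S))"
  note alt = alternating_pfaffian_form[of X, OF X]
  have e: "entry (gdet X S a a) \<alpha> \<beta> = ?P ((a, \<alpha>) # (a, \<beta>) # doubled ?L)" for \<alpha> \<beta>
    using mdet_gdet_pfaffian[of X, OF X S refl] a by blast
  have "entry (gdet X S a a) \<alpha> \<beta> = - entry (gdet X S a a) \<beta> \<alpha>" for \<alpha> \<beta>
    unfolding e using alternatingD[OF alt, of "Suc (card S)" "[]"] by (metis append_Nil)
  then have "gdet X S a a = cq_scalar (entry (gdet X S a a) True False)"
    by (rule entry_scalar_eqI)
  also have "entry (gdet X S a a) True False = pfdet X (insert a S)"
    unfolding e using S a by (subst pfdet_eq_pfaffian[OF X, of "a # ?L"]) auto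
  also have "cq_scalar \<dots> = mdet X (insert a S)"
    using mdet_eq_pfdet[of X, OF X] S by simp
  finally show ?thesis by simp
qed

lemma doubled_map: "doubled (map f L) = map (map_prod f id) (doubled L)"
  by (induction L) simp_all

text \<open>Relabelling changes which index leads a cycle and the order of the cycles, but in the
  Pfaffian it only permutes pairs.\<close>

lemma mdet_reindex:
  assumes X: "\<And>i j. X j i = cq_conj (X i j)" and f: "inj_on f S" and S: "finite S"
  shows "mdet (\<lambda>i j. X (f i) (f j)) S = mdet X (f ` S)"
proof -
  let ?L = "sorted_list_of_set S"
  have form: "form (\<lambda>i j. X (f i) (f j)) = (\<lambda>v w. form X (map_prod f id v) (map_prod f id w))"
    by (auto simp: form_def fun_eq_iff)
  have "pfdet X (f ` S) = pfaffian (form X) (length (map f ?L)) (doubled (map f ?L))"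
    using f S by (intro pfdet_eq_pfaffian[of X, OF X]) (auto simp: distinct_map)
  then have "pfdet (\<lambda>i j. X (f i) (f j)) S = pfdet X (f ` S)"
    by (simp add: pfdet_def doubled_map pfaffian_map form)
  then show ?thesis
    using mdet_eq_pfdet[of X, OF X] mdet_eq_pfdet[of "\<lambda>i j. X (f i) (f j)", OF X] S by simp
qed

text \<open>Replacing \<open>q\<close> by \<open>p\<close> leaves the form unchanged, so the
  Pfaffian may be evaluated on a list in which both entries of the pair of \<open>p\<close> occur
  twice.\<close>

lemma mdet_repeated:
  assumes X: "\<And>i j. X j i = cq_conj (X i j)" and S: "finite S"
    and pq: "p \<in> S" "q \<in> S" "p \<noteq> q" and eq: "\<And>i. X p i = X q i"
  shows "mdet X S = 0"
proof -
  let ?R = "sorted_list_of_set (S - {p, q})" and ?P = "pfaffian (form X) (card S)"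
  define h where "h i = (if i = q then p else i)" for i
  note alt = alternating_pfaffian_form[of X, OF X]
  have eq': "X i p = X i q" for i
    using X[of i p] X[of i q] X[of p i] X[of q i] eq[of i] by simp
  have form: "form X = (\<lambda>v w. form X (map_prod h id v) (map_prod h id w))"
    using eq eq' by (auto simp: form_def fun_eq_iff h_def)
  have R: "distinct (p # q # ?R)" "set (p # q # ?R) = S"
    using S pq by auto
  then have "pfdet X S = ?P (doubled (p # q # ?R))"
    using pfdet_eq_pfaffian[of X, OF X R] distinct_card[OF R(1)] by simp
  also have "\<dots> = ?P (map (map_prod h id) (doubled (p # q # ?R)))"
    by (subst pfaffian_map, subst form) (rule refl)
  also have "\<dots> = ?P ([(p, True)] @ (p, False) # (p, True) # (p, False) # doubled (map h ?R))"
    using pq by (simp add: h_def doubled_map del: pfaffian.simps)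
  \<comment> \<open>Swapping the second and third entries puts two equal entries in front, where
    alternation makes the value its own negative.\<close>
  also have "\<dots> = 0"
    unfolding alternatingD[OF alt, of _ "[(p, True)]" "(p, False)" "(p, True)"]
    using alternatingD[OF alt, of "card S" "[]" "(p, True)" "(p, True)"] by simp
  finally show ?thesis using mdet_eq_pfdet[of X, OF X S] by (simp add: cq_scalar_0)
qed

section \<open>Kernels in diagonal form and their dependence on the eigenvalues\<close>

definition kernel :: "'i set \<Rightarrow> ('i \<Rightarrow> complex) \<Rightarrow> ('i \<Rightarrow> 'a \<Rightarrow> cquat) \<Rightarrow> 'a \<Rightarrow> 'a \<Rightarrow> cquat" where
  "kernel J c u x y = (\<Sum>k\<in>J. cq_scalar (c k) * u k x * cq_conj (u k y))"

lemma kernel_self_dual: "kernel J c u y x = cq_conj (kernel J c u x y)"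
  unfolding kernel_def cq_conj_sum
  by (intro sum.cong refl) (simp add: cq_conj_mult cq_conj_scalar cq_conj_conj cq_scalar_commute mult.assoc)

text \<open>By \<open>entry_mult\<close> and \<open>entry_conj\<close> the kernel
  \<open>u(x) u*(y)\<close> becomes a decomposable two-form, whose factors are the two columns of
  the block of \<open>u\<close>.\<close>

lemma form_kernel:
  "form (\<lambda>i j. kernel J c u (x i) (x j)) v w = (\<Sum>k\<in>J. c k *
    (entry (u k (x (fst v))) (snd v) True * entry (u k (x (fst w))) (snd w) False -
     entry (u k (x (fst w))) (snd w) True * entry (u k (x (fst v))) (snd v) False))"
  unfolding form_def kernel_def entry_sum
  by (intro sum.cong refl) (simp add: mult.assoc entry_scalar_mult, simp add: entry_mult entry_conj)

lemma pfdet_kernel_affine: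
  assumes J: "finite J" "k \<in> J"
  shows "\<exists>a b. \<forall>t. pfdet (\<lambda>i j. kernel J (c(k := t)) u (x i) (x j)) S = a + t * b"
proof -
  define \<alpha> \<beta> where "\<alpha> v = entry (u k (x (fst v))) (snd v) True"
    and "\<beta> v = entry (u k (x (fst v))) (snd v) False" for v :: "nat \<times> bool"
  define A where "A = form (\<lambda>i j. kernel (J - {k}) c u (x i) (x j))"
  have A: "form (\<lambda>i j. kernel J (c(k := t)) u (x i) (x j)) =
      (\<lambda>v w. A v w + t * (\<alpha> v * \<beta> w - \<alpha> w * \<beta> v))" for t
    unfolding A_def fun_eq_iff form_kernel
    by (simp add: sum.remove[OF J] \<alpha>_def \<beta>_def)
  show ?thesis
    unfolding pfdet_def A by (rule pfaffian_affine)
qed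

text \<open>An affine function of \<open>t\<close> is \<open>t\<close> times its value at 1 plus
  \<open>1 - t\<close> times its value at 0; apply this to the coordinates in \<open>J\<close> one
  after another, leaving the others at \<open>c\<close>. For coordinates in [0,1] the coefficients
  are the probabilities of an independent random subset.\<close>

lemma multiaffine_expansion:
  fixes F :: "('i \<Rightarrow> complex) \<Rightarrow> complex"
  assumes "finite J" and "\<And>c k. k \<in> J \<Longrightarrow> \<exists>a b. \<forall>t. F (c(k := t)) = a + t * b"
  shows "F c = (\<Sum>I\<in>Pow J. (\<Prod>k\<in>I. c k) * (\<Prod>k\<in>J - I. 1 - c k) *
    F (\<lambda>k. if k \<in> J then if k \<in> I then 1 else 0 else c k))"
  using assms
proof (induction J arbitrary: c rule: finite_induct)
  case empty
  then show ?case by simp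
next
  case (insert k J)
  let ?e = "\<lambda>J I c k. if k \<in> J then if k \<in> I then 1 else 0 else c k"
  obtain a b where ab: "\<And>t. F (c(k := t)) = a + t * b"
    using insert.prems[of k c] by blast
  have "F c = c k * F (c(k := 1)) + (1 - c k) * F (c(k := 0))"
    using ab[of "c k"] ab[of 0] ab[of 1] by (simp add: algebra_simps)
  moreover have "F (c(k := t)) = (\<Sum>I\<in>Pow J. (\<Prod>k\<in>I. c k) * (\<Prod>k\<in>J - I. 1 - c k) *
      F (?e J I (c(k := t))))" for t
  proof -
    have "(\<Prod>l\<in>I. (c(k := t)) l) = (\<Prod>l\<in>I. c l)" if "I \<subseteq> J" for I
      using that insert.hyps by (intro prod.cong) auto
    moreover have "(\<Prod>l\<in>J - I. 1 - (c(k := t)) l) = (\<Prod>l\<in>J - I. 1 - c l)" for I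
      using insert.hyps by (intro prod.cong) auto
    ultimately show ?thesis
      by (subst insert.IH) (auto intro!: insert.prems sum.cong simp del: fun_upd_apply)
  qed
  ultimately have "F c =
      (\<Sum>I\<in>Pow J. c k * ((\<Prod>k\<in>I. c k) * (\<Prod>k\<in>J - I. 1 - c k) * F (?e J I (c(k := 1))))) +
      (\<Sum>I\<in>Pow J. (1 - c k) * ((\<Prod>k\<in>I. c k) * (\<Prod>k\<in>J - I. 1 - c k) * F (?e J I (c(k := 0)))))"
    by (simp add: sum_distrib_left)
  also have "(\<Sum>I\<in>Pow J. c k * ((\<Prod>k\<in>I. c k) * (\<Prod>k\<in>J - I. 1 - c k) * F (?e J I (c(k := 1))))) =
      (\<Sum>I\<in>insert k ` Pow J. (\<Prod>k\<in>I. c k) * (\<Prod>k\<in>insert k J - I. 1 - c k) * F (?e (insert k J) I c))"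
  proof (subst sum.reindex)
    show "inj_on (insert k) (Pow J)"
      using insert.hyps by (auto simp: inj_on_def)
    show "(\<Sum>I\<in>Pow J. c k * ((\<Prod>k\<in>I. c k) * (\<Prod>k\<in>J - I. 1 - c k) * F (?e J I (c(k := 1))))) =
      (\<Sum>I\<in>Pow J. ((\<lambda>I. (\<Prod>k\<in>I. c k) * (\<Prod>k\<in>insert k J - I. 1 - c k) *
        F (?e (insert k J) I c)) \<circ> insert k) I)"
    proof (intro sum.cong refl)
      fix I assume "I \<in> Pow J"
      then have I: "finite I" "k \<notin> I" using insert.hyps by (auto intro: finite_subset)
      have "?e (insert k J) (insert k I) c = ?e J I (c(k := 1))"
        using insert.hyps by auto
      moreover have "insert k J - insert k I = J - I" using insert.hyps by auto
      ultimately show "c k * ((\<Prod>k\<in>I. c k) * (\<Prod>k\<in>J - I. 1 - c k) * F (?e J I (c(k := 1)))) =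
        ((\<lambda>I. (\<Prod>k\<in>I. c k) * (\<Prod>k\<in>insert k J - I. 1 - c k) * F (?e (insert k J) I c)) \<circ> insert k) I"
        using I by (simp add: mult.assoc)
    qed
  qed
  also have "(\<Sum>I\<in>Pow J. (1 - c k) * ((\<Prod>k\<in>I. c k) * (\<Prod>k\<in>J - I. 1 - c k) * F (?e J I (c(k := 0))))) =
      (\<Sum>I\<in>Pow J. (\<Prod>k\<in>I. c k) * (\<Prod>k\<in>insert k J - I. 1 - c k) * F (?e (insert k J) I c))"
  proof (intro sum.cong refl)
    fix I assume "I \<in> Pow J"
    then have I: "k \<notin> I" "insert k J - I = insert k (J - I)" using insert.hyps by auto
    have "?e (insert k J) I c = ?e J I (c(k := 0))"
      using I insert.hyps by auto
    then show "(1 - c k) * ((\<Prod>k\<in>I. c k) * (\<Prod>k\<in>J - I. 1 - c k) * F (?e J I (c(k := 0)))) =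
      (\<Prod>k\<in>I. c k) * (\<Prod>k\<in>insert k J - I. 1 - c k) * F (?e (insert k J) I c)"
      using insert.hyps I by simp
  qed
  finally show ?case
    unfolding Pow_insert using insert.hyps by (subst sum.union_disjoint) auto
qed

section \<open>Projection kernels\<close>

lemma mdet_cong:
  assumes "finite S" and "\<And>i j. i \<in> S \<Longrightarrow> j \<in> S \<Longrightarrow> X i j = Y i j"
  shows "mdet X S = mdet Y S"
proof -
  have "cycle_products X \<sigma> (leaders S \<sigma>) = cycle_products Y \<sigma> (leaders S \<sigma>)"
    if \<sigma>: "\<sigma> permutes S" for \<sigma>
  proof -
    have funpow: "(\<sigma> ^^ t) a \<in> S" if "a \<in> S" for a t
      using that by (induction t) (simp_all add: permutes_in_image[OF \<sigma>])
    have "cycle_product X \<sigma> a = cycle_product Y \<sigma> a" if "a \<in> S" for a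
      unfolding cycle_product_def using funpow[OF that]
      by (intro arg_cong[of _ _ prod_list] map_cong refl assms(2)) (auto simp del: funpow.simps)
    then show ?thesis
      unfolding cycle_products_def using assms(1)
      by (intro arg_cong[of _ _ prod_list] map_cong) (auto simp: leaders_def)
  qed
  then show ?thesis unfolding mdet_def by simp
qed

section \<open>Integrals of quaternion-valued functions\<close>

lemma cq_components_add_diff:
  "cq_s (p + q) = cq_s p + cq_s q" "cq_x (p + q) = cq_x p + cq_x q"
  "cq_y (p + q) = cq_y p + cq_y q" "cq_z (p + q) = cq_z p + cq_z q"
  "cq_s (p - q) = cq_s p - cq_s q" "cq_x (p - q) = cq_x p - cq_x q"
  "cq_y (p - q) = cq_y p - cq_y q" "cq_z (p - q) = cq_z p - cq_z q"
  by (simp_all add: cquat_defs)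

lemma cq_s_sum: "cq_s (sum f A) = (\<Sum>x\<in>A. cq_s (f x))"
  by (induction A rule: infinite_finite_induct) (simp_all add: cq_components_add_diff zero_cquat_def)

lemma cq_s_commute: "cq_s (p * q) = cq_s (q * p)"
  by (simp add: cquat_defs algebra_simps)

lemma cq_has_integral_0: "cq_has_integral M (\<lambda>x. 0) 0"
  unfolding cq_has_integral_def by (simp add: zero_cquat_def has_bochner_integral_zero)

lemma cq_has_integral_add:
  "cq_has_integral M f p \<Longrightarrow> cq_has_integral M g q \<Longrightarrow> cq_has_integral M (\<lambda>x. f x + g x) (p + q)"
  unfolding cq_has_integral_def cq_components_add_diff by (intro conjI has_bochner_integral_add) simp_all

lemma cq_has_integral_diff:
  "cq_has_integral M f p \<Longrightarrow> cq_has_integral M g q \<Longrightarrow> cq_has_integral M (\<lambda>x. f x - g x) (p - q)"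
  unfolding cq_has_integral_def cq_components_add_diff by (intro conjI has_bochner_integral_diff) simp_all

lemma cq_has_integral_sum:
  assumes "\<And>k. k \<in> A \<Longrightarrow> cq_has_integral M (f k) (q k)"
  shows "cq_has_integral M (\<lambda>x. \<Sum>k\<in>A. f k x) (\<Sum>k\<in>A. q k)"
  using assms
  by (induction A rule: infinite_finite_induct) (auto intro: cq_has_integral_0 cq_has_integral_add)

lemma cq_has_integral_mult_right:
  assumes "cq_has_integral M f q"
  shows "cq_has_integral M (\<lambda>x. p * f x) (p * q)"
proof -
  have *: "has_bochner_integral M (\<lambda>x. c * h x) (c * r)"
    if "has_bochner_integral M h r" for c r :: complex and h
    using that by (rule has_bochner_integral_mult_right)
  show ?thesis
    using assms unfolding cq_has_integral_def times_cquat_def cquat.sel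
    by (intro conjI has_bochner_integral_add has_bochner_integral_diff *) simp_all
qed

lemma cq_has_integral_mult_left:
  assumes "cq_has_integral M f q"
  shows "cq_has_integral M (\<lambda>x. f x * p) (q * p)"
proof -
  have *: "has_bochner_integral M (\<lambda>x. h x * c) (r * c)"
    if "has_bochner_integral M h r" for c r :: complex and h
    using that by (rule has_bochner_integral_mult_left)
  show ?thesis
    using assms unfolding cq_has_integral_def times_cquat_def cquat.sel
    by (intro conjI has_bochner_integral_add has_bochner_integral_diff *) simp_all
qed

lemma mult_conj_commute: "q * cq_conj q = cq_conj q * q"
  by (simp add: cquat_defs algebra_simps)

locale projection_kernel = sigma_finite_measure \<mu> for \<mu> :: "'a::topological_space measure" +
  fixes I :: "'i set" and u :: "'i \<Rightarrow> 'a \<Rightarrow> cquat"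
  assumes finite_I: "finite I" and orthonormal: "orthonormal_family \<mu> I u"
    and positive: "positive_kernel (space \<mu>) (\<lambda>x y. \<Sum>k\<in>I. u k x * cq_conj (u k y))"
begin

abbreviation P :: "'a \<Rightarrow> 'a \<Rightarrow> cquat" where "P \<equiv> kernel I (\<lambda>_. 1) u"

abbreviation PX :: "(nat \<Rightarrow> 'a) \<Rightarrow> nat \<Rightarrow> nat \<Rightarrow> cquat" where "PX x \<equiv> \<lambda>i j. P (x i) (x j)"

lemma P_eq: "P x y = (\<Sum>k\<in>I. u k x * cq_conj (u k y))"
  by (simp add: kernel_def cq_scalar_1)

lemma PX_self_dual: "PX x j i = cq_conj (PX x i j)"
  by (rule kernel_self_dual)

lemma P_idempotent: "cq_has_integral \<mu> (\<lambda>y. P x y * P y z) (P x z)"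
proof -
  have "cq_has_integral \<mu> (\<lambda>y. \<Sum>k\<in>I. \<Sum>l\<in>I. u k x * ((cq_conj (u k y) * u l y) * cq_conj (u l z)))
      (\<Sum>k\<in>I. \<Sum>l\<in>I. u k x * ((if k = l then 1 else 0) * cq_conj (u l z)))"
    using orthonormal unfolding orthonormal_family_def
    by (intro cq_has_integral_sum cq_has_integral_mult_right cq_has_integral_mult_left) blast
  also have "(\<lambda>y. \<Sum>k\<in>I. \<Sum>l\<in>I. u k x * ((cq_conj (u k y) * u l y) * cq_conj (u l z))) =
      (\<lambda>y. P x y * P y z)"
    unfolding P_eq sum_product by (simp add: mult.assoc)
  also have "(\<Sum>k\<in>I. \<Sum>l\<in>I. u k x * ((if k = l then 1 else 0) * cq_conj (u l z))) = P x z"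
    unfolding P_eq
  proof (intro sum.cong refl)
    fix k assume "k \<in> I"
    have "(\<Sum>l\<in>I. u k x * ((if k = l then 1 else 0) * cq_conj (u l z))) =
        (\<Sum>l\<in>I. if k = l then u k x * cq_conj (u l z) else 0)"
      by (intro sum.cong) auto
    then show "(\<Sum>l\<in>I. u k x * ((if k = l then 1 else 0) * cq_conj (u l z))) = u k x * cq_conj (u k z)"
      using finite_I \<open>k \<in> I\<close> by simp
  qed
  finally show ?thesis .
qed

text \<open>On the diagonal the kernel is a sum of products \<open>u u*\<close>, whereas
  orthonormality concerns \<open>u* u\<close>; a quaternion commutes with its conjugate.\<close>

lemma P_trace: "cq_has_integral \<mu> (\<lambda>y. P y y) (cq_scalar (of_nat (card I)))"
proof -
  have "cq_has_integral \<mu> (\<lambda>y. \<Sum>k\<in>I. cq_conj (u k y) * u k y) (\<Sum>k\<in>I. 1)"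
    using orthonormal unfolding orthonormal_family_def
    by (intro cq_has_integral_sum) (metis (full_types))
  moreover have "cq_scalar (of_nat n) = of_nat n" for n
    by (induction n) (simp_all add: cq_scalar_0 cq_scalar_add cq_scalar_1)
  ultimately show ?thesis by (simp add: P_eq mult_conj_commute)
qed

lemma mdet_PX: "finite S \<Longrightarrow> mdet (PX x) S = cq_scalar (pfdet (PX x) S)"
  by (rule mdet_eq_pfdet[OF PX_self_dual])

lemma pfdet_cong:
  "finite S \<Longrightarrow> (\<And>i. i \<in> S \<Longrightarrow> x i = y i) \<Longrightarrow> pfdet (PX x) S = pfdet (PX y) S"
  using mdet_cong[of S "PX x" "PX y"] by (simp add: mdet_PX cq_scalar_inj)

text \<open>Since \<open>n\<close> is not in \<open>S\<close>, the variable \<open>y\<close> occurs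
  in \<open>gdet\<close> only at the open end, as the second argument of a last factor. Unrolling
  \<open>gdet_rec\<close> exposes that factor next to \<open>P y (x j)\<close>, and the reproducing
  property replaces the end \<open>y\<close> by \<open>x j\<close>.\<close>

lemma gdet_integral:
  assumes "finite S" "n \<notin> S" "a \<notin> S" "a \<noteq> n" "j \<noteq> n"
  shows "cq_has_integral \<mu> (\<lambda>y. gdet (PX (x(n := y))) S a n * P y (x j)) (gdet (PX x) S a j)"
  using assms
proof (induction "card S" arbitrary: S a)
  case 0
  then have "S = {}" by simp
  then show ?case using 0 P_idempotent by (simp add: gdet_rec mdet_empty)
next
  case (Suc m)
  note rec = gdet_rec[OF Suc.prems(1,3)]
  have M: "mdet (PX (x(n := y))) S = cq_scalar (pfdet (PX x) S)" for y
    using Suc.prems by (auto simp: mdet_PX cq_scalar_inj intro!: pfdet_cong)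
  have IH: "cq_has_integral \<mu> (\<lambda>y. gdet (PX (x(n := y))) (S - {i}) i n * P y (x j))
      (gdet (PX x) (S - {i}) i j)" if "i \<in> S" for i
    using Suc that by (intro Suc.hyps) auto
  have "cq_has_integral \<mu> (\<lambda>y. cq_scalar (pfdet (PX x) S) * (P (x a) y * P y (x j)) -
        (\<Sum>i\<in>S. P (x a) (x i) * (gdet (PX (x(n := y))) (S - {i}) i n * P y (x j))))
      (cq_scalar (pfdet (PX x) S) * P (x a) (x j) - (\<Sum>i\<in>S. P (x a) (x i) * gdet (PX x) (S - {i}) i j))"
    by (intro cq_has_integral_diff cq_has_integral_sum cq_has_integral_mult_right P_idempotent IH)
  also have "(\<lambda>y. cq_scalar (pfdet (PX x) S) * (P (x a) y * P y (x j)) -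
        (\<Sum>i\<in>S. P (x a) (x i) * (gdet (PX (x(n := y))) (S - {i}) i n * P y (x j)))) =
      (\<lambda>y. gdet (PX (x(n := y))) S a n * P y (x j))"
  proof
    fix y
    have "(\<Sum>i\<in>S. P ((x(n := y)) a) ((x(n := y)) i) * gdet (PX (x(n := y))) (S - {i}) i n) =
        (\<Sum>i\<in>S. P (x a) (x i) * gdet (PX (x(n := y))) (S - {i}) i n)"
      using Suc.prems by (intro sum.cong) auto
    then show "cq_scalar (pfdet (PX x) S) * (P (x a) y * P y (x j)) -
        (\<Sum>i\<in>S. P (x a) (x i) * (gdet (PX (x(n := y))) (S - {i}) i n * P y (x j))) =
      gdet (PX (x(n := y))) S a n * P y (x j)"
      unfolding rec M using Suc.prems
      by (simp add: cq_scalar_commute left_diff_distrib sum_distrib_right mult.assoc del: fun_upd_apply)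
        simp
  qed
  also have "cq_scalar (pfdet (PX x) S) * P (x a) (x j) -
      (\<Sum>i\<in>S. P (x a) (x i) * gdet (PX x) (S - {i}) i j) = gdet (PX x) S a j"
    unfolding rec using Suc.prems by (simp add: mdet_PX cq_scalar_commute)
  finally show ?case .
qed

text \<open>Only the scalar part of the expansion of the determinant is integrated, since cyclic
  permutation of the factors is needed.\<close>

lemma pfdet_integral:
  assumes S: "finite S" "n \<notin> S"
  shows "has_bochner_integral \<mu> (\<lambda>y. pfdet (PX (x(n := y))) (insert n S))
    ((of_nat (card I) - of_nat (card S)) * pfdet (PX x) S)"
proof -
  let ?x = "\<lambda>y. x(n := y)"
  have scalar: "cq_s (cq_scalar c) = c" "cq_s (q * cq_scalar c) = c * cq_s q" for c q
    by (simp_all add: cquat_defs)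
  have M: "mdet (PX (?x y)) S = cq_scalar (pfdet (PX x) S)" for y
    using S by (auto simp: mdet_PX cq_scalar_inj intro!: pfdet_cong)
  have eq: "pfdet (PX (?x y)) (insert n S) = pfdet (PX x) S * cq_s (P y y) -
      (\<Sum>j\<in>S. cq_s (gdet (PX (?x y)) (S - {j}) j n * P y (x j)))" for y
  proof -
    have "pfdet (PX (?x y)) (insert n S) = cq_s (mdet (PX (?x y)) (insert n S))"
      using S by (simp add: mdet_PX scalar del: fun_upd_apply)
    also have "\<dots> = cq_s (P y y * mdet (PX (?x y)) S -
        (\<Sum>j\<in>S. P y (?x y j) * gdet (PX (?x y)) (S - {j}) j n))"
      unfolding mdet_insert[of "PX (?x y)", OF PX_self_dual S] gdet_rec[OF S] by simp
    \<comment> \<open>Cyclic invariance of the scalar part moves \<open>P y (x j)\<close> to the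
      right, next to the open end at \<open>y\<close>.\<close>
    also have "\<dots> = pfdet (PX x) S * cq_s (P y y) -
      (\<Sum>j\<in>S. cq_s (gdet (PX (?x y)) (S - {j}) j n * P y (?x y j)))"
      unfolding M cq_components_add_diff cq_s_sum scalar
      by (intro arg_cong2[where f = "(-)"] sum.cong refl cq_s_commute)
    also have "(\<Sum>j\<in>S. cq_s (gdet (PX (?x y)) (S - {j}) j n * P y (?x y j))) =
        (\<Sum>j\<in>S. cq_s (gdet (PX (?x y)) (S - {j}) j n * P y (x j)))"
      using S by (intro sum.cong) auto
    finally show ?thesis .
  qed
  have "has_bochner_integral \<mu> (\<lambda>y. cq_s (gdet (PX (?x y)) (S - {j}) j n * P y (x j)))
      (cq_s (gdet (PX x) (S - {j}) j j))" if "j \<in> S" for j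
    using gdet_integral[of "S - {j}" n j j x] S that unfolding cq_has_integral_def by auto
  \<comment> \<open>Here \<open>j\<close> is the successor of the integrated point in its cycle.
    Every \<open>j\<close> returns the same determinant over \<open>S\<close>, which accounts for
    the summand \<open>- card S\<close>; the fixed point contributes the trace
    \<open>card I\<close>.\<close>
  moreover have "cq_s (gdet (PX x) (S - {j}) j j) = pfdet (PX x) S" if "j \<in> S" for j
    using mdet_insert[of "PX x", OF PX_self_dual, of "S - {j}" j] S that
    by (metis Diff_iff finite_Diff insertI1 insert_Diff mdet_PX scalar(1))
  moreover have "has_bochner_integral \<mu> (\<lambda>y. cq_s (P y y)) (of_nat (card I))"
    using P_trace unfolding cq_has_integral_def by (simp add: cq_scalar_def)
  ultimately have "has_bochner_integral \<mu> (\<lambda>y. pfdet (PX x) S * cq_s (P y y) -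
      (\<Sum>j\<in>S. cq_s (gdet (PX (?x y)) (S - {j}) j n * P y (x j))))
      (pfdet (PX x) S * of_nat (card I) - (\<Sum>j\<in>S. pfdet (PX x) S))"
    by (intro has_bochner_integral_diff has_bochner_integral_sum has_bochner_integral_mult_right)
      auto
  then show ?thesis unfolding eq by (simp add: algebra_simps)
qed

definition D :: "nat set \<Rightarrow> (nat \<Rightarrow> 'a) \<Rightarrow> real" where
  "D S x = Re (pfdet (PX x) S)"

text \<open>A nonnegative quaternion is in particular a real scalar, so positivity gives both
  claims. It speaks of indices below \<open>m\<close>, and \<open>mdet_reindex\<close> carries it
  over to \<open>S\<close>.\<close>

lemma D_pfdet:
  assumes S: "finite S" and x: "\<And>i. i \<in> S \<Longrightarrow> x i \<in> space \<mu>"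
  shows "pfdet (PX x) S = complex_of_real (D S x) \<and> 0 \<le> D S x"
proof (cases "S = {}")
  case True
  have "cq_scalar (pfdet (PX x) {}) = cq_scalar 1"
    using mdet_PX[of "{}" x] by (simp add: mdet_empty cq_scalar_1)
  then show ?thesis using True by (simp add: D_def cq_scalar_inj)
next
  case False
  obtain f where f: "bij_betw f {..<card S} S"
    using ex_bij_betw_nat_finite[OF S] by (auto simp: atLeast0LessThan)
  have f_in: "f i \<in> S" if "i < card S" for i
    using f that by (auto simp: bij_betw_def)
  have "cq_nonneg (moore_dyson_det (card S) (\<lambda>i j. P ((x \<circ> f) i) ((x \<circ> f) j)))"
    using positive False S x f_in unfolding positive_kernel_def P_eq
    by (simp add: Suc_le_eq card_gt_0_iff)
  then have "cq_nonneg (mdet (\<lambda>i j. PX x (f i) (f j)) {..<card S})"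
    unfolding moore_dyson_det_eq_mdet by simp
  also have "mdet (\<lambda>i j. PX x (f i) (f j)) {..<card S} = cq_scalar (pfdet (PX x) S)"
    using mdet_reindex[of "PX x", OF PX_self_dual, of f "{..<card S}"] f S
    by (simp add: bij_betw_def mdet_PX)
  finally show ?thesis
    unfolding cq_nonneg_def by (auto simp: cq_scalar_inj D_def)
qed

lemma D_nonneg: "finite S \<Longrightarrow> (\<And>i. i \<in> S \<Longrightarrow> x i \<in> space \<mu>) \<Longrightarrow> 0 \<le> D S x"
  using D_pfdet by blast

lemma D_cong: "finite S \<Longrightarrow> (\<And>i. i \<in> S \<Longrightarrow> x i = y i) \<Longrightarrow> D S x = D S y"
  unfolding D_def using pfdet_cong by metis

lemma D_empty: "D {} x = 1"
proof -
  have "cq_scalar (pfdet (PX x) {}) = cq_scalar 1"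
    using mdet_PX[of "{}" x] by (simp add: mdet_empty cq_scalar_1)
  then show ?thesis by (simp add: D_def cq_scalar_inj)
qed

lemma D_reindex:
  assumes "inj_on f S" "finite S"
  shows "D S (\<lambda>i. x (f i)) = D (f ` S) x"
  using mdet_reindex[of "PX x", OF PX_self_dual assms] assms mdet_PX[of S "\<lambda>i. x (f i)"]
  by (simp add: mdet_PX cq_scalar_inj D_def)

lemma D_repeated:
  assumes "finite S" "p \<in> S" "q \<in> S" "p \<noteq> q" "\<And>k. k \<in> I \<Longrightarrow> u k (x p) = u k (x q)"
  shows "D S x = 0"
proof -
  have "mdet (PX x) S = 0"
    using assms by (intro mdet_repeated[of "PX x", OF PX_self_dual, of S p q]) (auto simp: P_eq)
  then have "cq_scalar (pfdet (PX x) S) = cq_scalar 0"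
    using assms(1) by (simp add: mdet_PX cq_scalar_0)
  then show ?thesis by (simp add: cq_scalar_inj D_def)
qed

text \<open>The second claim holds because the value is the integral of a nonnegative function. It
  carries information when \<open>card S\<close> exceeds \<open>card I\<close> and the factor is
  negative.\<close>

lemma D_integral:
  assumes S: "finite S" "n \<notin> S" and x: "\<And>i. i \<in> S \<Longrightarrow> x i \<in> space \<mu>"
  shows "(\<integral>\<^sup>+ y. ennreal (D (insert n S) (x(n := y))) \<partial>\<mu>) =
      ennreal ((real (card I) - real (card S)) * D S x)" (is ?int)
    and "0 \<le> (real (card I) - real (card S)) * D S x" (is ?nonneg)
proof -
  have "has_bochner_integral \<mu> (\<lambda>y. D (insert n S) (x(n := y)))
      (Re ((of_nat (card I) - of_nat (card S)) * pfdet (PX x) S))"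
    unfolding D_def
    by (rule has_bochner_integral_bounded_linear[OF bounded_linear_Re pfdet_integral[OF S]])
  moreover have "Re ((of_nat (card I) - of_nat (card S)) * pfdet (PX x) S) =
      (real (card I) - real (card S)) * D S x"
    by (simp add: D_def)
  ultimately have int: "has_bochner_integral \<mu> (\<lambda>y. D (insert n S) (x(n := y)))
      ((real (card I) - real (card S)) * D S x)" by (simp only:)
  have nonneg: "0 \<le> D (insert n S) (x(n := y))" if "y \<in> space \<mu>" for y
    using S x that by (intro D_nonneg) auto
  show ?int
    using int nonneg by (subst nn_integral_eq_integral) (auto simp: has_bochner_integral_iff)
  have "0 \<le> (LINT y|\<mu>. D (insert n S) (x(n := y)))"
    using nonneg by (intro integral_nonneg_AE) auto
  then show ?nonneg
    using int by (simp add: has_bochner_integral_iff)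
qed

text \<open>Integrating out one further point would multiply the nonnegative number
  \<open>D S x\<close> by a negative factor, yet the outcome is nonnegative.\<close>

lemma D_eq_0:
  assumes S: "finite S" "card I < card S" and x: "\<And>i. i \<in> S \<Longrightarrow> x i \<in> space \<mu>"
  shows "D S x = 0"
proof -
  obtain n where "n \<notin> S" using S(1) ex_new_if_finite infinite_UNIV_nat by blast
  then have "0 \<le> (real (card I) - real (card S)) * D S x"
    using D_integral(2)[of S n x] S x by blast
  then show ?thesis
    using S D_nonneg[of S x] x by (auto simp: zero_le_mult_iff)
qed

end

section \<open>Repeated integration\<close>

lemma contract_measurable:
  assumes "\<And>v. v \<in> V \<Longrightarrow> (\<lambda>x. a x v) \<in> borel_measurable M"
    and "\<And>us. set us \<subseteq> V \<Longrightarrow> (\<lambda>x. f x us) \<in> borel_measurable M" and "set vs \<subseteq> V"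
  shows "(\<lambda>x. contract (a x) (f x) vs) \<in> borel_measurable M"
  using assms(2,3)
proof (induction vs arbitrary: f)
  case (Cons v vs)
  have "(\<lambda>x. contract (a x) (\<lambda>us. f x (v # us)) vs) \<in> borel_measurable M"
    using Cons.prems by (intro Cons.IH) auto
  moreover have "(\<lambda>x. f x vs) \<in> borel_measurable M" "(\<lambda>x. a x v) \<in> borel_measurable M"
    using Cons.prems assms(1) by auto
  ultimately show ?case by simp
qed simp

lemma pfaffian_measurable:
  assumes "\<And>v w. v \<in> V \<Longrightarrow> w \<in> V \<Longrightarrow> (\<lambda>x. A x v w) \<in> borel_measurable M" and "set vs \<subseteq> V"
  shows "(\<lambda>x. pfaffian (A x) n vs) \<in> borel_measurable M"
  using assms(2)
proof (induction n arbitrary: vs)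
  case (Suc n)
  show ?case
  proof (cases vs)
    case (Cons v ws)
    then show ?thesis
      using Suc assms(1) by (auto intro!: contract_measurable[where V = V])
  qed simp
qed simp

lemma set_doubled: "set (doubled L) = set L \<times> UNIV"
  by (induction L) (auto simp: UNIV_bool)

text \<open>A repeated factor \<open>C i\<close> loses one element for each of its earlier occurrences.\<close>

lemma card_injections_snoc:
  fixes C :: "nat \<Rightarrow> 'p set"
  defines "S \<equiv> \<lambda>b. {f \<in> PiE {..<length b} (\<lambda>s. C (b ! s)). inj_on f {..<length b}}"
  assumes fin: "\<And>j. j \<in> set b \<Longrightarrow> finite (C j)" "finite (C i)"
    and disj: "\<And>j. j \<in> set b \<Longrightarrow> j \<noteq> i \<Longrightarrow> C j \<inter> C i = {}"
  shows "card (S (b @ [i])) = card (S b) * (card (C i) - count_list b i)"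
proof -
  let ?k = "length b"
  have "finite (PiE {..<?k} (\<lambda>s. C (b ! s)))"
    by (intro finite_PiE fin nth_mem) simp_all
  then have finS: "finite (S b)"
    unfolding S_def by (rule rev_finite_subset) blast
  have eq: "S (b @ [i]) = (\<lambda>(f, p). f(?k := p)) ` (SIGMA f : S b. C i - f ` {..<?k})"
  proof (intro set_eqI iffI)
    fix g assume "g \<in> S (b @ [i])"
    then have g: "g \<in> PiE {..<Suc ?k} (\<lambda>s. C ((b @ [i]) ! s))" "inj_on g {..<Suc ?k}"
      by (auto simp: S_def)
    let ?f = "restrict g {..<?k}"
    have "?f \<in> S b"
      unfolding S_def
    proof (intro CollectI conjI PiE_I)
      fix s assume "s \<in> {..<?k}"
      then show "?f s \<in> C (b ! s)"
        using PiE_mem[OF g(1), of s] by (simp add: nth_append)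
    next
      show "inj_on ?f {..<?k}"
        using g(2) by (auto simp: inj_on_def)
    qed simp
    moreover have "g ?k \<in> C i - ?f ` {..<?k}"
      using inj_onD[OF g(2), of _ ?k] PiE_mem[OF g(1), of ?k] by fastforce
    moreover have "g = ?f(?k := g ?k)"
      using g(1) by (auto simp: fun_eq_iff PiE_iff extensional_def restrict_def less_Suc_eq)
    ultimately show "g \<in> (\<lambda>(f, p). f(?k := p)) ` (SIGMA f : S b. C i - f ` {..<?k})"
      by (intro image_eqI[where x = "(?f, g ?k)"]) auto
  next
    fix g assume "g \<in> (\<lambda>(f, p). f(?k := p)) ` (SIGMA f : S b. C i - f ` {..<?k})"
    then obtain f p where f: "f \<in> S b" and p: "p \<in> C i" "p \<notin> f ` {..<?k}" and g: "g = f(?k := p)"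
      by auto
    have "g \<in> PiE {..<Suc ?k} (\<lambda>s. C ((b @ [i]) ! s))"
      using f p unfolding g
      by (auto simp: S_def PiE_iff extensional_def nth_append less_Suc_eq)
    moreover have "inj_on g {..<Suc ?k}"
      using f p unfolding g S_def lessThan_Suc by (auto simp: inj_on_def)
    ultimately show "g \<in> S (b @ [i])" by (simp add: S_def)
  qed
  have inj: "inj_on (\<lambda>(f, p). f(?k := p)) (SIGMA f : S b. C i - f ` {..<?k})"
  proof (rule inj_onI, clarify)
    fix f p f' p' assume f: "f \<in> S b" "f' \<in> S b" and e: "f(?k := p) = f'(?k := p')"
    have "f s = f' s" for s
    proof (cases "s = ?k")
      case True
      then show ?thesis using f by (auto simp: S_def PiE_iff extensional_def)
    next
      case False
      then show ?thesis using fun_cong[OF e, of s] by simp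
    qed
    then show "f = f' \<and> p = p'" using fun_cong[OF e, of ?k] by auto
  qed
  have count: "card (C i - f ` {..<?k}) = card (C i) - count_list b i" if f: "f \<in> S b" for f
  proof -
    have "f s \<in> C (b ! s)" if "s < ?k" for s
      using f that by (auto simp: S_def)
    then have "f s \<in> C i \<longleftrightarrow> b ! s = i" if "s < ?k" for s
      using that disj[of "b ! s"] by (metis IntI empty_iff nth_mem)
    then have "f ` {..<?k} \<inter> C i = f ` {s. s < ?k \<and> b ! s = i}"
      by auto
    moreover have "inj_on f {s. s < ?k \<and> b ! s = i}"
      using f by (auto simp: S_def inj_on_def)
    ultimately have "card (f ` {..<?k} \<inter> C i) = card {s. s < ?k \<and> b ! s = i}"
      by (simp add: card_image)
    also have "\<dots> = count_list b i"
      by (simp add: count_list_eq_length_filter length_filter_conv_card eq_commute)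
    finally show ?thesis
      using card_Diff_subset_Int[of "C i" "f ` {..<?k}"] fin(2) by (simp add: Int_commute)
  qed
  have "card (S (b @ [i])) = (\<Sum>f\<in>S b. card (C i - f ` {..<?k}))"
    unfolding eq card_image[OF inj] using finS fin by (intro card_SigmaI) auto
  also have "\<dots> = card (S b) * (card (C i) - count_list b i)"
    by (simp add: count)
  finally show ?thesis .
qed

text \<open>The falling factorials fill the blocks one position at a time; by disjointness only
  earlier positions of the same block exclude a value. This turns factorial moments into sums over
  tuples of distinct points.\<close>

lemma card_injections:
  fixes C :: "nat \<Rightarrow> 'p set" and l :: "nat \<Rightarrow> nat"
  assumes fin: "\<And>i. i < m \<Longrightarrow> finite (C i)" and disj: "disjoint_family_on C {..<m}"
  defines "b \<equiv> concat (map (\<lambda>i. replicate (l i) i) [0..<m])"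
  shows "card {f \<in> PiE {..<length b} (\<lambda>s. C (b ! s)). inj_on f {..<length b}} =
    (\<Prod>i<m. \<Prod>j<l i. card (C i) - j)"
proof -
  let ?S = "\<lambda>b. {f \<in> PiE {..<length b} (\<lambda>s. C (b ! s)). inj_on f {..<length b}}"
  have "card (?S (concat (map (\<lambda>i. replicate (l i) i) [0..<n]))) = (\<Prod>i<n. \<Prod>j<l i. card (C i) - j)"
    if "n \<le> m" for n
    using that
  proof (induction n)
    case 0
    have "?S [] = {\<lambda>_. undefined}" by auto
    then show ?case by simp
  next
    case (Suc n)
    define B where "B = concat (map (\<lambda>i. replicate (l i) i) [0..<n])"
    have b: "j < n" if "j \<in> set B" for j
      using that unfolding B_def by auto
    have count: "count_list (B @ replicate t n) n = t" for t
    proof -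
      have "count_list (replicate t n) n = t" by (induction t) simp_all
      moreover have "n \<notin> set B" using b by blast
      ultimately show ?thesis by simp
    qed
    have "card (?S (B @ replicate t n)) = card (?S B) * (\<Prod>j<t. card (C n) - j)" for t
    proof (induction t)
      case (Suc t)
      have "card (?S ((B @ replicate t n) @ [n])) =
          card (?S (B @ replicate t n)) * (card (C n) - count_list (B @ replicate t n) n)"
      proof (rule card_injections_snoc)
        fix j assume j: "j \<in> set (B @ replicate t n)"
        then have "j \<le> n" using b by (auto simp: less_imp_le)
        then show "finite (C j)" using fin \<open>Suc n \<le> m\<close> by simp
        assume "j \<noteq> n"
        then show "C j \<inter> C n = {}"
          using disj \<open>j \<le> n\<close> \<open>Suc n \<le> m\<close> by (auto simp: disjoint_family_on_def)
      qed (use fin \<open>Suc n \<le> m\<close> in simp)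
      also have "(B @ replicate t n) @ [n] = B @ replicate (Suc t) n"
        by (simp add: replicate_append_same)
      finally show ?case unfolding Suc.IH count by (simp add: mult.assoc)
    qed simp
    from this[of "l n"] show ?case using Suc by (simp add: B_def)
  qed
  then show ?thesis unfolding b_def by simp
qed

lemma ennreal_of_nat_diff: "(of_nat a :: ennreal) - of_nat b = of_nat (a - b)"
proof (cases "b \<le> a")
  case True
  then show ?thesis
    by (simp add: ennreal_of_nat_eq_real_of_nat ennreal_minus of_nat_diff)
next
  case False
  then show ?thesis
    by (simp add: ennreal_of_nat_eq_real_of_nat ennreal_minus ennreal_neg)
qed

text \<open>Boxes pull back to boxes with the same sides, and their measures determine a
  sigma-finite product. It serves to rename any \<open>k\<close> chosen coordinates to the first
  \<open>k\<close>.\<close>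

lemma distr_PiM_reindex_sigma_finite:
  fixes \<mu> :: "'a measure" and f :: "'i \<Rightarrow> 'j"
  assumes "sigma_finite_measure \<mu>" and K: "finite K" and f: "inj_on f K"
  shows "distr (PiM (f ` K) (\<lambda>_. \<mu>)) (PiM K (\<lambda>_. \<mu>)) (\<lambda>x. \<lambda>i\<in>K. x (f i)) = PiM K (\<lambda>_. \<mu>)"
proof -
  interpret sigma_finite_measure \<mu> by fact
  interpret K: product_sigma_finite "\<lambda>_ :: 'i. \<mu>" by standard
  interpret J: product_sigma_finite "\<lambda>_ :: 'j. \<mu>" by standard
  have [measurable]: "(\<lambda>x. \<lambda>i\<in>K. x (f i)) \<in> measurable (PiM (f ` K) (\<lambda>_. \<mu>)) (PiM K (\<lambda>_. \<mu>))"
    by (intro measurable_restrict measurable_component_singleton) auto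
  show ?thesis
  proof (rule K.PiM_eqI[OF K])
    fix A assume A: "\<And>i. i \<in> K \<Longrightarrow> A i \<in> sets \<mu>"
    let ?g = "the_inv_into K f"
    have g: "?g (f i) = i" if "i \<in> K" for i
      using that f by (simp add: the_inv_into_f_f)
    have "(\<lambda>x. \<lambda>i\<in>K. x (f i)) -` PiE K A \<inter> space (PiM (f ` K) (\<lambda>_. \<mu>)) = PiE (f ` K) (\<lambda>j. A (?g j))"
      using A[THEN sets.sets_into_space] by (auto simp: space_PiM PiE_iff g) blast
    then have "emeasure (distr (PiM (f ` K) (\<lambda>_. \<mu>)) (PiM K (\<lambda>_. \<mu>)) (\<lambda>x. \<lambda>i\<in>K. x (f i))) (PiE K A) =
        emeasure (PiM (f ` K) (\<lambda>_. \<mu>)) (PiE (f ` K) (\<lambda>j. A (?g j)))"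
      using A K by (subst emeasure_distr) (auto intro!: sets_PiM_I_finite)
    also have "\<dots> = (\<Prod>j\<in>f ` K. emeasure \<mu> (A (?g j)))"
      using A K by (intro J.emeasure_PiM) (auto simp: g)
    also have "\<dots> = (\<Prod>i\<in>K. emeasure \<mu> (A i))"
      using f by (simp add: prod.reindex g)
    finally show "emeasure (distr (PiM (f ` K) (\<lambda>_. \<mu>)) (PiM K (\<lambda>_. \<mu>)) (\<lambda>x. \<lambda>i\<in>K. x (f i))) (PiE K A) =
        (\<Prod>i\<in>K. emeasure \<mu> (A i))" .
  qed simp
qed

context projection_kernel
begin

sublocale product_sigma_finite "\<lambda>_ :: nat. \<mu>"
  by standard

lemma u_measurable: "k \<in> I \<Longrightarrow> cq_measurable \<mu> (u k)"
  using orthonormal unfolding orthonormal_family_def by blast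

lemma cq_sel_u_measurable:
  assumes "k \<in> I" "p \<in> S"
  shows "(\<lambda>x. cq_s (u k (x p))) \<in> borel_measurable (PiM S (\<lambda>_. \<mu>))"
    "(\<lambda>x. cq_x (u k (x p))) \<in> borel_measurable (PiM S (\<lambda>_. \<mu>))"
    "(\<lambda>x. cq_y (u k (x p))) \<in> borel_measurable (PiM S (\<lambda>_. \<mu>))"
    "(\<lambda>x. cq_z (u k (x p))) \<in> borel_measurable (PiM S (\<lambda>_. \<mu>))"
  using u_measurable[OF assms(1)] unfolding cq_measurable_def
  by (auto intro: measurable_compose[OF measurable_component_singleton[OF assms(2)]])

lemma D_measurable:
  assumes "finite S" "S \<subseteq> S'"
  shows "D S \<in> borel_measurable (PiM S' (\<lambda>_. \<mu>))"
proof -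
  have [measurable]: "(\<lambda>x. entry (u k (x p)) \<alpha> \<beta>) \<in> borel_measurable (PiM S' (\<lambda>_. \<mu>))"
    if "k \<in> I" "p \<in> S" for k p \<alpha> \<beta>
    using cq_sel_u_measurable[of k p S'] that assms(2)
    unfolding entry_def by (cases \<alpha>; cases \<beta>) auto
  have "(\<lambda>x. pfdet (PX x) S) \<in> borel_measurable (PiM S' (\<lambda>_. \<mu>))"
    unfolding pfdet_def
  proof (rule pfaffian_measurable[where V = "S \<times> UNIV"])
    fix v w :: "nat \<times> bool" assume "v \<in> S \<times> UNIV" "w \<in> S \<times> UNIV"
    then have "fst v \<in> S" "fst w \<in> S" by auto
    then show "(\<lambda>x. form (PX x) v w) \<in> borel_measurable (PiM S' (\<lambda>_. \<mu>))"
      unfolding form_kernel by measurable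
  qed (use assms in \<open>simp add: set_doubled\<close>)
  then show ?thesis unfolding D_def by measurable
qed

text \<open>The coordinates in \<open>R\<close> are integrated out one at a time, with factors
  descending from \<open>card I - card S\<close>; their product is the quotient of factorials. The
  function \<open>g\<close> sees only coordinates in \<open>S\<close> and leaves the inner
  integrals.\<close>

lemma nn_integral_D:
  assumes fin: "finite S" "finite R" and "S \<inter> R = {}" "card S + card R \<le> card I"
    and g: "g \<in> borel_measurable (PiM S (\<lambda>_. \<mu>))"
  shows "(\<integral>\<^sup>+ x. g (restrict x S) * ennreal (D (S \<union> R) x) \<partial>PiM (S \<union> R) (\<lambda>_. \<mu>)) =
    ennreal (fact (card I - card S) / fact (card I - card S - card R)) *
    (\<integral>\<^sup>+ x. g x * ennreal (D S x) \<partial>PiM S (\<lambda>_. \<mu>))"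
  using fin(2) assms(3,4)
proof (induction R rule: finite_induct)
  case empty
  have "restrict x S = x" if "x \<in> space (PiM S (\<lambda>_. \<mu>))" for x
    using that by (simp add: space_PiM extensional_restrict PiE_def)
  then have "(\<integral>\<^sup>+ x. g (restrict x S) * ennreal (D S x) \<partial>PiM S (\<lambda>_. \<mu>)) =
      (\<integral>\<^sup>+ x. g x * ennreal (D S x) \<partial>PiM S (\<lambda>_. \<mu>))"
    by (intro nn_integral_cong) (simp only:)
  then show ?case
    by (simp only: Un_empty_right card.empty diff_zero divide_self_if fact_nonzero if_False
        ennreal_1 mult_1)
next
  case (insert r R)
  let ?A = "S \<union> R"
  have A: "finite ?A" "r \<notin> ?A" "card ?A = card S + card R" "S \<union> insert r R = insert r ?A"
    using insert fin by (auto simp: card_Un_disjoint)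
  have gR: "(\<lambda>x. g (restrict x S)) \<in> borel_measurable (PiM B (\<lambda>_. \<mu>))" if "S \<subseteq> B" for B
    using g measurable_restrict_subset[OF that] by (rule measurable_compose[rotated])
  have "(\<integral>\<^sup>+ x. g (restrict x S) * ennreal (D (insert r ?A) x) \<partial>PiM (insert r ?A) (\<lambda>_. \<mu>)) =
      (\<integral>\<^sup>+ x. (\<integral>\<^sup>+ y. g (restrict (x(r := y)) S) * ennreal (D (insert r ?A) (x(r := y))) \<partial>\<mu>)
        \<partial>PiM ?A (\<lambda>_. \<mu>))"
    using A by (intro product_nn_integral_insert borel_measurable_times_ennreal gR
        measurable_compose[OF D_measurable measurable_ennreal]) auto
  also have "\<dots> = (\<integral>\<^sup>+ x. ennreal (real (card I) - real (card ?A)) *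
      (g (restrict x S) * ennreal (D ?A x)) \<partial>PiM ?A (\<lambda>_. \<mu>))"
  proof (rule nn_integral_cong)
    fix x assume x: "x \<in> space (PiM ?A (\<lambda>_. \<mu>))"
    then have xin: "x i \<in> space \<mu>" if "i \<in> ?A" for i
      using that by (auto simp: space_PiM PiE_iff)
    have r: "restrict (x(r := y)) S = restrict x S" for y
      using A by (auto simp: restrict_def fun_eq_iff)
    have "(\<lambda>y. x(r := y)) \<in> measurable \<mu> (PiM (insert r ?A) (\<lambda>_. \<mu>))"
      using x by (intro measurable_fun_upd[where J = ?A]) auto
    then have "(\<lambda>y. D (insert r ?A) (x(r := y))) \<in> borel_measurable \<mu>"
      using A by (intro measurable_compose[OF _ D_measurable]) auto
    then have "(\<integral>\<^sup>+ y. g (restrict (x(r := y)) S) * ennreal (D (insert r ?A) (x(r := y))) \<partial>\<mu>) =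
        g (restrict x S) * (\<integral>\<^sup>+ y. ennreal (D (insert r ?A) (x(r := y))) \<partial>\<mu>)"
      unfolding r by (intro nn_integral_cmult) simp
    also have "\<dots> = g (restrict x S) * ennreal ((real (card I) - real (card ?A)) * D ?A x)"
      using D_integral(1)[of ?A r x] A xin by simp
    also have "\<dots> = ennreal (real (card I) - real (card ?A)) * (g (restrict x S) * ennreal (D ?A x))"
      using insert A D_nonneg[of ?A x] xin by (simp add: ennreal_mult mult.left_commute)
    finally show "(\<integral>\<^sup>+ y. g (restrict (x(r := y)) S) * ennreal (D (insert r ?A) (x(r := y))) \<partial>\<mu>) =
        ennreal (real (card I) - real (card ?A)) * (g (restrict x S) * ennreal (D ?A x))" .
  qed
  also have "\<dots> = ennreal (real (card I) - real (card ?A)) *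
      (\<integral>\<^sup>+ x. g (restrict x S) * ennreal (D ?A x) \<partial>PiM ?A (\<lambda>_. \<mu>))"
    using A by (intro nn_integral_cmult borel_measurable_times_ennreal gR
        measurable_compose[OF D_measurable measurable_ennreal]) auto
  also have "\<dots> = ennreal (real (card I) - real (card ?A)) *
      ennreal (fact (card I - card S) / fact (card I - card S - card R)) *
      (\<integral>\<^sup>+ x. g x * ennreal (D S x) \<partial>PiM S (\<lambda>_. \<mu>))"
    by (subst insert.IH) (use insert in \<open>auto simp: mult.assoc\<close>)
  also have "ennreal (real (card I) - real (card ?A)) *
      ennreal (fact (card I - card S) / fact (card I - card S - card R)) =
      ennreal (fact (card I - card S) / fact (card I - card S - card (insert r R)))"
  proof -
    have c: "card I - card S - card R = Suc (card I - card S - card (insert r R))"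
      using insert by simp
    have "real (card I) - real (card ?A) = real (Suc (card I - card S - card (insert r R)))"
      using insert A by (simp add: of_nat_diff)
    then show ?thesis
      unfolding c fact_Suc by (subst ennreal_mult[symmetric]) (simp_all del: of_nat_Suc)
  qed
  finally show ?case unfolding A(4) .
qed

end

section \<open>The point field of a projection kernel\<close>

lemma num_points_measurable:
  assumes "A \<in> sets \<mu>"
  shows "num_points A \<in> borel_measurable (configuration_space \<mu>)"
proof (rule measurableI)
  have gen: "{{\<xi> \<in> configurations (space \<mu>). num_points A \<xi> \<in> B} | A B. A \<in> sets \<mu> \<and> B \<in> sets borel}
      \<subseteq> Pow (configurations (space \<mu>))"
    by auto
  fix B :: "ennreal set" assume "B \<in> sets borel"
  then have "{\<xi> \<in> configurations (space \<mu>). num_points A \<xi> \<in> B} \<in> sets (configuration_space \<mu>)"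
    unfolding configuration_space_def sets_measure_of[OF gen] using assms by (intro sigma_sets.Basic) blast
  also have "{\<xi> \<in> configurations (space \<mu>). num_points A \<xi> \<in> B} =
      num_points A -` B \<inter> space (configuration_space \<mu>)"
    unfolding configuration_space_def space_measure_of[OF gen] by auto
  finally show "num_points A -` B \<inter> space (configuration_space \<mu>) \<in> sets (configuration_space \<mu>)" .
qed simp

lemma num_points_image:
  assumes "finite S" "inj_on x S"
  shows "num_points A (x ` S) = of_nat (card {p \<in> S. x p \<in> A})"
proof -
  have "x ` S \<inter> A = x ` {p \<in> S. x p \<in> A}" by auto
  moreover have "inj_on x {p \<in> S. x p \<in> A}"
    by (rule inj_on_subset[OF assms(2)]) auto
  ultimately have "card (x ` S \<inter> A) = card {p \<in> S. x p \<in> A}"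
    by (simp add: card_image)
  then show ?thesis
    unfolding num_points_def using assms(1) by (subst emeasure_count_space_finite) auto
qed

lemma prod_diff_mult_fact: "k \<le> n \<Longrightarrow> (\<Prod>j<k. n - j) * fact (n - k) = (fact n :: nat)"
proof (induction k)
  case (Suc k)
  then have "n - k = Suc (n - Suc k)" by simp
  then have "fact (n - k) = (n - k) * fact (n - Suc k)"
    by (metis fact_Suc of_nat_id)
  then show ?case using Suc by (simp add: mult.assoc)
qed simp

context projection_kernel
begin

text \<open>The coordinates outside the image of \<open>f\<close> integrate out to
  \<open>fact (card I - k)\<close>. Symmetry of the determinant and of the product measure renames
  the others, so the value is the same for every \<open>f\<close>.\<close>

lemma nn_integral_injection:
  assumes f: "inj_on f {..<k}" "f \<in> {..<k} \<rightarrow> {..<card I}" and E: "E \<in> sets (PiM {..<k} (\<lambda>_. \<mu>))"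
  shows "(\<integral>\<^sup>+ x. indicator E (\<lambda>s\<in>{..<k}. x (f s)) * ennreal (D {..<card I} x) \<partial>PiM {..<card I} (\<lambda>_. \<mu>)) =
    ennreal (fact (card I - k)) * (\<integral>\<^sup>+ x. indicator E x * ennreal (D {..<k} x) \<partial>PiM {..<k} (\<lambda>_. \<mu>))"
proof -
  let ?S = "f ` {..<k}"
  let ?R = "{..<card I} - ?S"
  let ?T = "\<lambda>x. \<lambda>s\<in>{..<k}. x (f s)"
  have S: "?S \<union> ?R = {..<card I}" "card ?S = k" "k \<le> card I"
    using f card_inj_on_le[OF f(1), of "{..<card I}"] by (auto simp: card_image)
  then have R: "card ?R = card I - k"
    by (subst card_Diff_subset) auto
  have T: "?T \<in> measurable (PiM ?S (\<lambda>_. \<mu>)) (PiM {..<k} (\<lambda>_. \<mu>))"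
    by (intro measurable_restrict measurable_component_singleton) auto
  have g: "(\<lambda>x. indicator E (?T x) :: ennreal) \<in> borel_measurable (PiM ?S (\<lambda>_. \<mu>))"
    by (rule measurable_compose[OF T borel_measurable_indicator[OF E]])
  have h: "(\<lambda>x. indicator E x * ennreal (D {..<k} x)) \<in> borel_measurable (PiM {..<k} (\<lambda>_. \<mu>))"
    by (intro borel_measurable_times_ennreal borel_measurable_indicator E
        measurable_compose[OF D_measurable measurable_ennreal]) auto
  have "(\<integral>\<^sup>+ x. indicator E (?T x) * ennreal (D {..<card I} x) \<partial>PiM {..<card I} (\<lambda>_. \<mu>)) =
      (\<integral>\<^sup>+ x. indicator E (?T (restrict x ?S)) * ennreal (D (?S \<union> ?R) x) \<partial>PiM (?S \<union> ?R) (\<lambda>_. \<mu>))"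
  proof -
    have "?T (restrict x ?S) = ?T x" for x :: "nat \<Rightarrow> 'a"
      by (auto simp: restrict_def fun_eq_iff)
    then show ?thesis unfolding S(1) by (simp only:)
  qed
  also have "\<dots> = ennreal (fact (card I - card ?S) / fact (card I - card ?S - card ?R)) *
    (\<integral>\<^sup>+ x. indicator E (?T x) * ennreal (D ?S x) \<partial>PiM ?S (\<lambda>_. \<mu>))"
    using S R by (intro nn_integral_D g) auto
  also have "fact (card I - card ?S) / fact (card I - card ?S - card ?R) = (fact (card I - k) :: real)"
    unfolding R S(2) by simp
  also have "(\<integral>\<^sup>+ x. indicator E (?T x) * ennreal (D ?S x) \<partial>PiM ?S (\<lambda>_. \<mu>)) =
      (\<integral>\<^sup>+ x. indicator E (?T x) * ennreal (D {..<k} (?T x)) \<partial>PiM ?S (\<lambda>_. \<mu>))"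
  proof -
    have "D {..<k} (?T x) = D ?S x" for x
      unfolding D_reindex[OF f(1) finite_lessThan, symmetric] by (rule D_cong) auto
    then show ?thesis by (simp only:)
  qed
  also have "\<dots> = (\<integral>\<^sup>+ x. indicator E x * ennreal (D {..<k} x) \<partial>distr (PiM ?S (\<lambda>_. \<mu>)) (PiM {..<k} (\<lambda>_. \<mu>)) ?T)"
    by (subst nn_integral_distr[OF T]) (simp_all add: h)
  also have "\<dots> = (\<integral>\<^sup>+ x. indicator E x * ennreal (D {..<k} x) \<partial>PiM {..<k} (\<lambda>_. \<mu>))"
    by (subst distr_PiM_reindex_sigma_finite[OF sigma_finite_measure_axioms finite_lessThan f(1)]) (rule refl)
  finally show ?thesis .
qed

text \<open>Requiring the values of \<open>u\<close>, not just the points, to be distinct makes the event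
  measurable although the diagonal need not be; its complement is a null set for the density.\<close>

definition separated :: "(nat \<Rightarrow> 'a) \<Rightarrow> bool" where
  "separated x \<longleftrightarrow>
     (\<forall>p\<in>{..<card I}. \<forall>q\<in>{..<card I} - {p}. \<exists>k\<in>I. u k (x p) \<noteq> u k (x q))"

text \<open>The density vanishes on tuples that are not separated, so the value there is free; the
  empty configuration keeps every counting map measurable.\<close>

definition point_set :: "(nat \<Rightarrow> 'a) \<Rightarrow> 'a set" where
  "point_set x = (if separated x then x ` {..<card I} else {})"

definition process :: "'a set measure" where
  "process = distr (density (PiM {..<card I} (\<lambda>_. \<mu>)) (\<lambda>x. ennreal (1 / fact (card I)) * ennreal (D {..<card I} x)))
     (configuration_space \<mu>) point_set"

lemma separated_inj_on: "separated x \<Longrightarrow> inj_on x {..<card I}"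
  unfolding separated_def inj_on_def by (metis Diff_iff empty_iff insert_iff)

lemma D_not_separated: "\<not> separated x \<Longrightarrow> D {..<card I} x = 0"
  unfolding separated_def by (auto intro: D_repeated)

lemma separated_measurable: "Measurable.pred (PiM {..<card I} (\<lambda>_. \<mu>)) separated"
proof -
  have eq: "Measurable.pred (PiM {..<card I} (\<lambda>_. \<mu>)) (\<lambda>x. u k (x p) = u k (x q))"
    if "k \<in> I" "p < card I" "q < card I" for k p q
  proof -
    have eq: "a = b \<longleftrightarrow> cq_s a = cq_s b \<and> cq_x a = cq_x b \<and> cq_y a = cq_y b \<and> cq_z a = cq_z b" for a b
      by (auto intro: cquat.expand)
    have pred_eq: "Measurable.pred M (\<lambda>x. f x = g x)"
      if "f \<in> borel_measurable M" "g \<in> borel_measurable M"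
      for M :: "(nat \<Rightarrow> 'a) measure" and f g :: "(nat \<Rightarrow> 'a) \<Rightarrow> complex"
      unfolding pred_def by (rule measurable_equality_set[OF that])
    show ?thesis
      unfolding eq using that by (intro pred_intros_logic pred_eq cq_sel_u_measurable) auto
  qed
  have "separated = (\<lambda>x. \<forall>p\<in>{..<card I}. \<forall>q\<in>{..<card I} - {p}. \<exists>k\<in>I. \<not> u k (x p) = u k (x q))"
    by (simp add: fun_eq_iff separated_def)
  also have "Measurable.pred (PiM {..<card I} (\<lambda>_. \<mu>)) \<dots>"
    using finite_I by (intro pred_intros_finite pred_intros_logic eq) auto
  finally show ?thesis .
qed

lemma num_points_point_set:
  "num_points A (point_set x) = (if separated x then of_nat (card {p. p < card I \<and> x p \<in> A}) else 0)"
  using num_points_image[OF finite_lessThan separated_inj_on]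
  by (auto simp: point_set_def num_points_def)

lemma point_set_configuration:
  assumes "x \<in> space (PiM {..<card I} (\<lambda>_. \<mu>))"
  shows "point_set x \<in> configurations (space \<mu>)"
proof -
  have "finite (point_set x)" "point_set x \<subseteq> space \<mu>"
    using assms by (auto simp: point_set_def space_PiM PiE_iff)
  then show ?thesis by (simp add: configurations_def countable_finite)
qed

lemma point_set_measurable:
  "point_set \<in> measurable (PiM {..<card I} (\<lambda>_. \<mu>)) (configuration_space \<mu>)"
  unfolding configuration_space_def
proof (rule measurable_measure_of)
  show "point_set \<in> space (PiM {..<card I} (\<lambda>_. \<mu>)) \<rightarrow> configurations (space \<mu>)"
    using point_set_configuration by blast
next
  fix G assume "G \<in> {{\<xi> \<in> configurations (space \<mu>). num_points A \<xi> \<in> B} | A B. A \<in> sets \<mu> \<and> B \<in> sets borel}"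
  then obtain A B where A: "A \<in> sets \<mu>" and B: "B \<in> sets borel"
    and G: "G = {\<xi> \<in> configurations (space \<mu>). num_points A \<xi> \<in> B}"
    by blast
  have "of_nat (card {p. p < card I \<and> x p \<in> A}) = (\<Sum>p<card I. indicator A (x p) :: ennreal)" for x :: "nat \<Rightarrow> 'a"
    by (simp add: indicator_def sum.If_cases Int_def conj_commute)
  then have num: "num_points A (point_set x) = (if separated x then \<Sum>p<card I. indicator A (x p) else 0)" for x
    by (simp add: num_points_point_set)
  note [measurable] = separated_measurable
  have [measurable]: "(\<lambda>x. indicator A (x p) :: ennreal) \<in> borel_measurable (PiM {..<card I} (\<lambda>_. \<mu>))"
    if "p < card I" for p
    using that A by (intro measurable_compose[OF measurable_component_singleton borel_measurable_indicator]) auto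
  have "(\<lambda>x. num_points A (point_set x)) \<in> borel_measurable (PiM {..<card I} (\<lambda>_. \<mu>))"
    unfolding num by measurable
  from measurable_sets[OF this B]
  show "point_set -` G \<inter> space (PiM {..<card I} (\<lambda>_. \<mu>)) \<in> sets (PiM {..<card I} (\<lambda>_. \<mu>))"
  proof (rule back_subst[where P = "\<lambda>S. S \<in> sets (PiM {..<card I} (\<lambda>_. \<mu>))"])
    show "(\<lambda>x. num_points A (point_set x)) -` B \<inter> space (PiM {..<card I} (\<lambda>_. \<mu>)) =
        point_set -` G \<inter> space (PiM {..<card I} (\<lambda>_. \<mu>))"
      unfolding G using point_set_configuration by blast
  qed
qed auto

lemma nn_integral_process:
  assumes "F \<in> borel_measurable (configuration_space \<mu>)"
  shows "(\<integral>\<^sup>+ \<xi>. F \<xi> \<partial>process) = (\<integral>\<^sup>+ x. ennreal (1 / fact (card I)) * ennreal (D {..<card I} x) *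
    F (point_set x) \<partial>PiM {..<card I} (\<lambda>_. \<mu>))"
proof -
  have "(\<lambda>x. ennreal (1 / fact (card I)) * ennreal (D {..<card I} x)) \<in> borel_measurable (PiM {..<card I} (\<lambda>_. \<mu>))"
    by (intro borel_measurable_times_ennreal borel_measurable_const
        measurable_compose[OF D_measurable measurable_ennreal]) auto
  then show ?thesis
    unfolding process_def using point_set_measurable assms
    by (subst nn_integral_distr) (auto simp: nn_integral_density
        intro!: nn_integral_density measurable_compose[OF point_set_measurable])
qed

lemma D_eq_0_on_space:
  "card I < k \<Longrightarrow> x \<in> space (PiM {..<k} (\<lambda>_. \<mu>)) \<Longrightarrow> D {..<k} x = 0"
  by (rule D_eq_0) (auto simp: space_PiM PiE_iff)

lemma emeasure_space_PiM_empty: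
  "emeasure (PiM ({} :: nat set) (\<lambda>_. \<mu>)) (space (PiM ({} :: nat set) (\<lambda>_. \<mu>))) = 1"
  using nn_integral_empty[of "\<lambda>_. 1"] by simp

text \<open>With \<open>N = card I\<close>, the product of falling factorials counts the injections
  \<open>f\<close> that select a \<open>k\<close>-tuple of points in \<open>E\<close>. Each
  contributes \<open>fact (N - k)\<close> times the same integral, there are
  \<open>fact N / fact (N - k)\<close> of them, and the normalization \<open>1 / fact N\<close>
  cancels the product. For \<open>k > N\<close> there is no injection, and the determinant vanishes
  too.\<close>

lemma process_correlation:
  fixes A :: "nat \<Rightarrow> 'a set" and l :: "nat \<Rightarrow> nat"
  assumes A: "\<And>i. i < m \<Longrightarrow> A i \<in> sets \<mu>" "disjoint_family_on A {..<m}" and k: "(\<Sum>i<m. l i) = k"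
  shows "(\<integral>\<^sup>+ \<xi>. (\<Prod>i<m. \<Prod>j<l i. num_points (A i) \<xi> - of_nat j) \<partial>process) =
    (\<integral>\<^sup>+ x \<in> PiE {..<k} (\<lambda>j. concat (map (\<lambda>i. replicate (l i) (A i)) [0..<m]) ! j).
      ennreal (D {..<k} x) \<partial>PiM {..<k} (\<lambda>_. \<mu>))"
proof -
  define b where "b = concat (map (\<lambda>i. replicate (l i) i) [0..<m])"
  define E where "E = PiE {..<k} (\<lambda>j. concat (map (\<lambda>i. replicate (l i) (A i)) [0..<m]) ! j)"
  define Inj where "Inj = {f \<in> {..<k} \<rightarrow>\<^sub>E {..<card I}. inj_on f {..<k}}"
  let ?N = "card I" and ?T = "\<lambda>x f. \<lambda>s\<in>{..<k}. x (f s)"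
  let ?int = "\<integral>\<^sup>+ x. indicator E x * ennreal (D {..<k} x) \<partial>PiM {..<k} (\<lambda>_. \<mu>)"
  have len: "length b = k"
    by (simp add: b_def length_concat k[symmetric] o_def interv_sum_list_conv_sum_set_nat atLeast0LessThan)
  have b: "b ! j < m" if "j < k" for j
  proof -
    have "set b \<subseteq> {..<m}" by (auto simp: b_def)
    then show ?thesis using that len nth_mem[of j b] by blast
  qed
  have "concat (map (\<lambda>i. replicate (l i) (A i)) [0..<m]) = map A b"
    by (simp add: b_def map_concat o_def)
  then have E_eq: "E = PiE {..<k} (\<lambda>j. A (b ! j))"
    unfolding E_def using len by (intro PiE_cong) simp
  have E: "E \<in> sets (PiM {..<k} (\<lambda>_. \<mu>))"
    unfolding E_eq using A b by (intro sets_PiM_I_finite) auto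
  have finInj: "finite Inj"
    unfolding Inj_def by (intro finite_subset[OF _ finite_PiE[of "{..<k}" "\<lambda>_. {..<?N}"]]) auto
  have pointwise: "ennreal (1 / fact ?N) * ennreal (D {..<?N} x) *
      (\<Prod>i<m. \<Prod>j<l i. num_points (A i) (point_set x) - of_nat j) =
    ennreal (1 / fact ?N) * (\<Sum>f\<in>Inj. indicator E (?T x f) * ennreal (D {..<?N} x))" for x
  proof (cases "separated x")
    case False
    then show ?thesis by (simp add: D_not_separated)
  next
    case True
    define C where "C i = {p. p < ?N \<and> x p \<in> A i}" for i
    have "(\<Prod>i<m. \<Prod>j<l i. num_points (A i) (point_set x) - of_nat j) =
        of_nat (\<Prod>i<m. \<Prod>j<l i. card (C i) - j)"
      using True by (simp add: num_points_point_set C_def ennreal_of_nat_diff)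
    also have "(\<Prod>i<m. \<Prod>j<l i. card (C i) - j) =
        card {f \<in> PiE {..<length b} (\<lambda>s. C (b ! s)). inj_on f {..<length b}}"
      unfolding b_def
    proof (rule card_injections[symmetric])
      show "disjoint_family_on C {..<m}"
        using A(2) unfolding disjoint_family_on_def C_def by blast
    qed (simp add: C_def)
    also have "{f \<in> PiE {..<length b} (\<lambda>s. C (b ! s)). inj_on f {..<length b}} =
        {f \<in> Inj. ?T x f \<in> E}"
      unfolding len E_eq Inj_def C_def by (auto simp: PiE_iff)
    also have "of_nat (card {f \<in> Inj. ?T x f \<in> E}) = (\<Sum>f\<in>Inj. indicator E (?T x f) :: ennreal)"
      using finInj by (simp add: indicator_def sum.If_cases Int_def)
    finally show ?thesis
      unfolding sum_distrib_right[symmetric] by (simp only: ac_simps)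
  qed
  have F: "(\<lambda>\<xi>. \<Prod>i<m. \<Prod>j<l i. num_points (A i) \<xi> - of_nat j) \<in> borel_measurable (configuration_space \<mu>)"
    using A by (intro borel_measurable_prod_ennreal borel_measurable_minus_ennreal
        borel_measurable_const num_points_measurable) auto
  have f: "inj_on f {..<k}" "f \<in> {..<k} \<rightarrow> {..<?N}" if "f \<in> Inj" for f
    using that by (auto simp: Inj_def)
  have meas: "(\<lambda>x. indicator E (?T x f) * ennreal (D {..<?N} x)) \<in> borel_measurable (PiM {..<?N} (\<lambda>_. \<mu>))"
    if "f \<in> Inj" for f
  proof -
    have "(\<lambda>x. ?T x f) \<in> measurable (PiM {..<?N} (\<lambda>_. \<mu>)) (PiM {..<k} (\<lambda>_. \<mu>))"
      using f(2)[OF that] by (intro measurable_restrict measurable_component_singleton) auto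
    from measurable_compose[OF this borel_measurable_indicator[OF E]] show ?thesis
      by (intro borel_measurable_times_ennreal measurable_compose[OF D_measurable measurable_ennreal]) auto
  qed
  have "(\<integral>\<^sup>+ \<xi>. (\<Prod>i<m. \<Prod>j<l i. num_points (A i) \<xi> - of_nat j) \<partial>process) =
      (\<integral>\<^sup>+ x. ennreal (1 / fact ?N) * (\<Sum>f\<in>Inj. indicator E (?T x f) * ennreal (D {..<?N} x))
        \<partial>PiM {..<?N} (\<lambda>_. \<mu>))"
    unfolding nn_integral_process[OF F] pointwise ..
  also have "\<dots> = ennreal (1 / fact ?N) * (\<Sum>f\<in>Inj.
      \<integral>\<^sup>+ x. indicator E (?T x f) * ennreal (D {..<?N} x) \<partial>PiM {..<?N} (\<lambda>_. \<mu>))"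
    by (simp only: nn_integral_cmult[OF borel_measurable_sum[OF meas]] nn_integral_sum[OF meas])
  also have "\<dots> = ennreal (1 / fact ?N) * (of_nat (card Inj) * (ennreal (fact (?N - k)) * ?int))"
    using nn_integral_injection[OF f E] by simp
  also have "\<dots> = ?int"
  proof (cases "k \<le> ?N")
    case True
    \<comment> \<open>The case of a single block of length \<open>k\<close>.\<close>
    have "card Inj = (\<Prod>j<k. ?N - j)"
      using card_injections[of 1 "\<lambda>_. {..<?N}" "\<lambda>_. k"]
      by (simp add: Inj_def disjoint_family_on_def)
    then have "card Inj * fact (?N - k) = fact ?N"
      using prod_diff_mult_fact[OF True] by simp
    then have "real (card Inj) * fact (?N - k) = fact ?N"
      by (metis of_nat_fact of_nat_mult)
    then have "ennreal (1 / fact ?N) * (of_nat (card Inj) * ennreal (fact (?N - k))) = 1"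
      by (simp add: ennreal_of_nat_eq_real_of_nat ennreal_mult[symmetric])
    then show ?thesis by (simp add: mult.assoc[symmetric])
  next
    case False
    have "Inj = {}"
    proof (rule ccontr)
      assume "Inj \<noteq> {}"
      then obtain g where "g \<in> Inj" by blast
      then show False using f card_inj_on_le[of g "{..<k}" "{..<?N}"] False by auto
    qed
    moreover have "?int = (\<integral>\<^sup>+ x. 0 \<partial>PiM {..<k} (\<lambda>_. \<mu>))"
      using False by (intro nn_integral_cong) (simp add: D_eq_0_on_space)
    ultimately show ?thesis by simp
  qed
  finally show ?thesis by (simp add: E_def mult.commute)
qed

lemma random_point_field_process: "random_point_field \<mu> process"
  unfolding random_point_field_def
proof (intro conjI prob_spaceI)
  have "emeasure process (space process) = (\<integral>\<^sup>+ \<xi>. 1 \<partial>process)"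
    by simp
  \<comment> \<open>The correlation identity for \<open>k = 0\<close> is the normalization: the
    product is empty, and the integral runs over a space with one point of mass 1.\<close>
  also have "\<dots> = 1"
    using process_correlation[of 0 "\<lambda>_. {}" "\<lambda>_. 0" 0]
    by (simp add: disjoint_family_on_def D_empty nn_integral_empty)
  finally show "emeasure process (space process) = 1" .
qed (simp_all add: process_def)

text \<open>Integrating out all coordinates by \<open>nn_integral_D\<close> gives a finite total, so
  local integrability comes from integrability on the whole power.\<close>

lemma integrable_D: "integrable (PiM {..<k} (\<lambda>_. \<mu>)) (D {..<k})"
proof (rule integrableI_bounded[OF D_measurable])
  have norm: "ennreal (norm (D {..<k} x)) = ennreal (D {..<k} x)" if "x \<in> space (PiM {..<k} (\<lambda>_. \<mu>))" for x
    using that D_nonneg[of "{..<k}" x] by (auto simp: space_PiM PiE_iff)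
  have "(\<integral>\<^sup>+ x. ennreal (D {..<k} x) \<partial>PiM {..<k} (\<lambda>_. \<mu>)) < \<infinity>"
  proof (cases "k \<le> card I")
    case True
    have "(\<integral>\<^sup>+ x. 1 * ennreal (D ({} \<union> {..<k}) x) \<partial>PiM ({} \<union> {..<k}) (\<lambda>_. \<mu>)) =
        ennreal (fact (card I - card ({} :: nat set)) / fact (card I - card ({} :: nat set) - card {..<k})) *
        (\<integral>\<^sup>+ x. 1 * ennreal (D {} x) \<partial>PiM {} (\<lambda>_. \<mu>))"
      using True by (intro nn_integral_D) auto
    then show ?thesis
      by (simp add: emeasure_space_PiM_empty D_empty ennreal_mult_less_top)
  next
    case False
    have "(\<integral>\<^sup>+ x. ennreal (D {..<k} x) \<partial>PiM {..<k} (\<lambda>_. \<mu>)) = (\<integral>\<^sup>+ x. 0 \<partial>PiM {..<k} (\<lambda>_. \<mu>))"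
      using False by (intro nn_integral_cong) (simp add: D_eq_0_on_space)
    then show ?thesis by simp
  qed
  then show "(\<integral>\<^sup>+ x. ennreal (norm (D {..<k} x)) \<partial>PiM {..<k} (\<lambda>_. \<mu>)) < \<infinity>"
    by (subst nn_integral_cong[OF norm])
qed auto

end

section \<open>Mixtures over sets of eigenfunctions\<close>

lemma bind_pmf_mixture:
  assumes "\<And>i. prob_space (Q i)" "\<And>i. sets (Q i) = sets N"
  shows "prob_space (measure_pmf p \<bind> Q)" "sets (measure_pmf p \<bind> Q) = sets N"
    and "F \<in> borel_measurable N \<Longrightarrow>
      (\<integral>\<^sup>+ \<xi>. F \<xi> \<partial>(measure_pmf p \<bind> Q)) = (\<integral>\<^sup>+ i. \<integral>\<^sup>+ \<xi>. F \<xi> \<partial>Q i \<partial>measure_pmf p)"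
proof -
  have p: "measure_pmf p \<in> space (prob_algebra (count_space UNIV))"
    by (simp add: space_prob_algebra prob_space_measure_pmf)
  have "Q i \<in> space (prob_algebra N)" for i
    using assms by (simp add: space_prob_algebra)
  then have Q: "Q \<in> measurable (count_space UNIV) (prob_algebra N)"
    by simp
  show "prob_space (measure_pmf p \<bind> Q)" by (rule prob_space_bind'[OF p Q])
  show "sets (measure_pmf p \<bind> Q) = sets N" by (rule sets_bind'[OF p Q])
  have "Q \<in> measurable (measure_pmf p) (subprob_algebra N)"
    using measurable_prob_algebraD[OF Q] by (simp add: measurable_pmf_measure1)
  then show "(\<integral>\<^sup>+ \<xi>. F \<xi> \<partial>(measure_pmf p \<bind> Q)) = (\<integral>\<^sup>+ i. \<integral>\<^sup>+ \<xi>. F \<xi> \<partial>Q i \<partial>measure_pmf p)"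
    if "F \<in> borel_measurable N"
    using that by (rule nn_integral_bind[rotated])
qed

section \<open>The random set of eigenfunctions and the averaged determinant\<close>

definition weight :: "'i set \<Rightarrow> ('i \<Rightarrow> real) \<Rightarrow> 'i set \<Rightarrow> real" where
  "weight J lam I = (if I \<subseteq> J then (\<Prod>k\<in>I. lam k) * (\<Prod>k\<in>J - I. 1 - lam k) else 0)"

lemma weight_nonneg:
  assumes "\<forall>k\<in>J. 0 \<le> lam k \<and> lam k \<le> 1"
  shows "0 \<le> weight J lam I"
  using assms unfolding weight_def by (auto intro!: mult_nonneg_nonneg prod_nonneg)

lemma nn_integral_weight:
  assumes "finite J" "\<forall>k\<in>J. 0 \<le> lam k \<and> lam k \<le> 1"
  shows "(\<integral>\<^sup>+ I. ennreal (weight J lam I) \<partial>count_space UNIV) = 1"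
proof -
  have "(\<integral>\<^sup>+ I. ennreal (weight J lam I) \<partial>count_space UNIV) = (\<Sum>I\<in>Pow J. ennreal (weight J lam I))"
    using assms by (intro nn_integral_count_space') (auto simp: weight_def)
  also have "\<dots> = ennreal (\<Sum>I\<in>Pow J. weight J lam I)"
    using weight_nonneg[OF assms(2)] by (intro sum_ennreal) auto
  \<comment> \<open>The weights of the subsets are the terms in the expansion of this product, each
    of whose factors is 1.\<close>
  also have "(\<Sum>I\<in>Pow J. weight J lam I) = (\<Prod>k\<in>J. lam k + (1 - lam k))"
    using assms(1) unfolding prod_add[OF assms(1)] by (intro sum.cong) (auto simp: weight_def)
  finally show ?thesis by simp
qed

lemma kernel_indicator:
  assumes "finite J" "I \<subseteq> J"
  shows "kernel J (\<lambda>k. if k \<in> J then if k \<in> I then 1 else 0 else c k) u = kernel I (\<lambda>_. 1) u"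
proof (intro ext)
  fix x y
  show "kernel J (\<lambda>k. if k \<in> J then if k \<in> I then 1 else 0 else c k) u x y = kernel I (\<lambda>_. 1) u x y"
    unfolding kernel_def using assms
    by (intro sum.mono_neutral_cong_right) (auto simp: cq_scalar_0)
qed

text \<open>A random subset makes the eigenvalues independent with values 0 and 1. As the Pfaffian
  is affine in each of them, taking the mean replaces every eigenvalue by its mean
  \<open>lam k\<close>.\<close>

lemma pfdet_kernel_expansion:
  assumes J: "finite J" and pk: "\<And>I. I \<subseteq> J \<Longrightarrow> projection_kernel \<mu> I u"
    and S: "finite S" and x: "\<And>i. i \<in> S \<Longrightarrow> x i \<in> space \<mu>"
  shows "pfdet (\<lambda>i j. kernel J (\<lambda>k. complex_of_real (lam k)) u (x i) (x j)) S =
    complex_of_real (\<Sum>I\<in>Pow J. weight J lam I * projection_kernel.D I u S x)"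
proof -
  let ?F = "\<lambda>c. pfdet (\<lambda>i j. kernel J c u (x i) (x j)) S"
  have "?F (\<lambda>k. complex_of_real (lam k)) =
      (\<Sum>I\<in>Pow J. (\<Prod>k\<in>I. complex_of_real (lam k)) * (\<Prod>k\<in>J - I. 1 - complex_of_real (lam k)) *
        ?F (\<lambda>k. if k \<in> J then if k \<in> I then 1 else 0 else complex_of_real (lam k)))"
    by (rule multiaffine_expansion[OF J pfdet_kernel_affine[OF J]])
  also have "\<dots> = (\<Sum>I\<in>Pow J. complex_of_real (weight J lam I * projection_kernel.D I u S x))"
  proof (intro sum.cong refl)
    fix I assume "I \<in> Pow J"
    then have I: "I \<subseteq> J" by simp
    have "pfdet (\<lambda>i j. kernel I (\<lambda>_. 1) u (x i) (x j)) S = complex_of_real (projection_kernel.D I u S x)"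
      using projection_kernel.D_pfdet[OF pk[OF I] S, of x] x by blast
    then show "(\<Prod>k\<in>I. complex_of_real (lam k)) * (\<Prod>k\<in>J - I. 1 - complex_of_real (lam k)) *
        ?F (\<lambda>k. if k \<in> J then if k \<in> I then 1 else 0 else complex_of_real (lam k)) =
        complex_of_real (weight J lam I * projection_kernel.D I u S x)"
      unfolding kernel_indicator[OF J I] using I by (simp add: weight_def)
  qed
  finally show ?thesis by simp
qed

theorem theorem1p4:
  fixes \<mu> :: "'a::topological_space measure"
    and K :: "'a \<Rightarrow> 'a \<Rightarrow> cquat"
    and J :: "'i set"
    and lam :: "'i \<Rightarrow> real"
    and u :: "'i \<Rightarrow> 'a \<Rightarrow> cquat"
  assumes "sigma_finite_measure \<mu>"
    and "quasi_real_form \<mu> J lam u K"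
    and "completely_positive \<mu> J u"
    and "\<forall>k\<in>J. 0 \<le> lam k \<and> lam k \<le> 1"
  shows "\<exists>P. pfaffian_point_field \<mu> K P"
proof -
  have J: "finite J" and orth: "orthonormal_family \<mu> J u"
    and K: "\<And>x y. x \<in> space \<mu> \<Longrightarrow> y \<in> space \<mu> \<Longrightarrow> K x y = kernel J (\<lambda>k. complex_of_real (lam k)) u x y"
    using assms(2) by (auto simp: quasi_real_form_def diagonal_form_def kernel_def)
  have pk: "projection_kernel \<mu> I u" if "I \<subseteq> J" for I
  proof (intro projection_kernel.intro projection_kernel_axioms.intro)
    show "finite I" using J that by (rule rev_finite_subset)
    show "orthonormal_family \<mu> I u" using orth that unfolding orthonormal_family_def by blast
    show "positive_kernel (space \<mu>) (\<lambda>x y. \<Sum>k\<in>I. u k x * cq_conj (u k y))"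
      using assms(3) that unfolding completely_positive_def by blast
  qed (rule assms(1))
  let ?w = "weight J lam" and ?D = "\<lambda>I. projection_kernel.D I u"
  let ?N = "configuration_space \<mu>"
  note w_nonneg = weight_nonneg[OF assms(4)]
  define R where "R k x = (\<Sum>I\<in>Pow J. ?w I * ?D I {..<k} x)" for k :: nat and x
  define p where "p = embed_pmf ?w"
  have pmf_p: "pmf p I = ?w I" for I
    unfolding p_def using w_nonneg nn_integral_weight[OF J assms(4)] by (rule pmf_embed_pmf)
  \<comment> \<open>The mixture asks for a probability space at every index set. Intersecting with
    \<open>J\<close> provides one also for sets not contained in \<open>J\<close>, which have weight
    0.\<close>
  define Q where "Q I = projection_kernel.process \<mu> (I \<inter> J) u" for I
  have Q: "random_point_field \<mu> (Q I)" for I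
    unfolding Q_def by (rule projection_kernel.random_point_field_process[OF pk]) simp
  then have Q': "prob_space (Q I)" "sets (Q I) = sets ?N" for I
    by (simp_all add: random_point_field_def)
  define P where "P = measure_pmf p \<bind> Q"
  note P_bind = bind_pmf_mixture[where p = p and Q = Q, OF Q']
  have rpf: "random_point_field \<mu> P"
    unfolding random_point_field_def P_def using P_bind(1,2) sets_eq_imp_space_eq[OF P_bind(2)] by blast
  have D_nonneg: "0 \<le> ?D I {..<k} x" if "I \<subseteq> J" "x \<in> space (PiM {..<k} (\<lambda>_. \<mu>))" for I k x
    using that(2) by (intro projection_kernel.D_nonneg[OF pk[OF that(1)]]) (auto simp: space_PiM PiE_iff)
  have corr: "correlation_function \<mu> P k (R k)" for k
    unfolding correlation_function_def locally_integrable_def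
  proof (intro conjI ballI allI impI)
    fix x assume "x \<in> PiE {..<k} (\<lambda>_. space \<mu>)"
    then show "0 \<le> R k x"
      unfolding R_def using D_nonneg w_nonneg
      by (intro sum_nonneg mult_nonneg_nonneg) (auto simp: space_PiM)
  next
    have int: "integrable (PiM {..<k} (\<lambda>_. \<mu>)) (R k)"
      unfolding R_def
      by (intro Bochner_Integration.integrable_sum integrable_mult_right
          projection_kernel.integrable_D[OF pk]) auto
    then show "R k \<in> borel_measurable (PiM {..<k} (\<lambda>_. \<mu>))"
      by (rule borel_measurable_integrable)
    fix C A assume "compact C \<and> C \<subseteq> space \<mu> \<and> A \<in> sets \<mu> \<and> A \<subseteq> C"
    then show "set_integrable (PiM {..<k} (\<lambda>_. \<mu>)) (PiE {..<k} (\<lambda>_. A)) (R k)"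
      unfolding set_integrable_def by (intro integrable_mult_indicator int sets_PiM_I_finite) auto
  next
    fix m :: nat and A :: "nat \<Rightarrow> 'a set" and l :: "nat \<Rightarrow> nat"
    assume A: "(\<forall>i<m. A i \<in> sets \<mu>) \<and> disjoint_family_on A {..<m} \<and> (\<Sum>i<m. l i) = k"
    let ?F = "\<lambda>\<xi>. \<Prod>i<m. \<Prod>j<l i. num_points (A i) \<xi> - of_nat j"
    let ?B = "\<lambda>j. concat (map (\<lambda>i. replicate (l i) (A i)) [0..<m]) ! j"
    let ?E = "PiE {..<k} ?B"
    have F: "?F \<in> borel_measurable ?N"
      using A by (intro borel_measurable_prod_ennreal borel_measurable_minus_ennreal
          borel_measurable_const num_points_measurable) auto
    have "concat (map (\<lambda>i. replicate (l i) (A i)) [0..<m]) ! j \<in> sets \<mu>" if "j < k" for j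
    proof -
      have "length (concat (map (\<lambda>i. replicate (l i) (A i)) [0..<m])) = k"
        using A by (simp add: length_concat o_def interv_sum_list_conv_sum_set_nat atLeast0LessThan)
      then have "?B j \<in> set (concat (map (\<lambda>i. replicate (l i) (A i)) [0..<m]))"
        using that nth_mem by metis
      then show ?thesis using A by auto
    qed
    then have E: "?E \<in> sets (PiM {..<k} (\<lambda>_. \<mu>))"
      by (intro sets_PiM_I_finite) auto
    have meas: "(\<lambda>x. ennreal (?D I {..<k} x) * indicator ?E x) \<in> borel_measurable (PiM {..<k} (\<lambda>_. \<mu>))"
      if "I \<subseteq> J" for I
      using projection_kernel.D_measurable[OF pk[OF that], of "{..<k}" "{..<k}"] E by simp
    have "(\<integral>\<^sup>+ \<xi>. ?F \<xi> \<partial>P) = (\<integral>\<^sup>+ I. \<integral>\<^sup>+ \<xi>. ?F \<xi> \<partial>Q I \<partial>measure_pmf p)"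
      unfolding P_def by (rule P_bind(3)[OF F])
    also have "\<dots> = (\<Sum>I\<in>Pow J. (\<integral>\<^sup>+ \<xi>. ?F \<xi> \<partial>Q I) * ennreal (?w I))"
      unfolding pmf_p[symmetric] using J
      by (intro nn_integral_measure_pmf_support) (auto simp: set_pmf_iff pmf_p weight_def)
    also have "\<dots> = (\<Sum>I\<in>Pow J. \<integral>\<^sup>+ x. ennreal (?w I) * (ennreal (?D I {..<k} x) * indicator ?E x)
        \<partial>PiM {..<k} (\<lambda>_. \<mu>))"
    proof (intro sum.cong refl)
      fix I assume "I \<in> Pow J"
      then have I: "I \<subseteq> J" "I \<inter> J = I" by auto
      have "(\<integral>\<^sup>+ \<xi>. ?F \<xi> \<partial>Q I) =
          (\<integral>\<^sup>+ x. ennreal (?D I {..<k} x) * indicator ?E x \<partial>PiM {..<k} (\<lambda>_. \<mu>))"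
        unfolding Q_def I(2) using A by (intro projection_kernel.process_correlation[OF pk[OF I(1)]]) auto
      then show "(\<integral>\<^sup>+ \<xi>. ?F \<xi> \<partial>Q I) * ennreal (?w I) =
          (\<integral>\<^sup>+ x. ennreal (?w I) * (ennreal (?D I {..<k} x) * indicator ?E x) \<partial>PiM {..<k} (\<lambda>_. \<mu>))"
        by (simp only: nn_integral_cmult[OF meas[OF I(1)]] mult.commute)
    qed
    also have "\<dots> = (\<integral>\<^sup>+ x. (\<Sum>I\<in>Pow J. ennreal (?w I) * (ennreal (?D I {..<k} x) * indicator ?E x))
        \<partial>PiM {..<k} (\<lambda>_. \<mu>))"
      by (rule nn_integral_sum[symmetric]) (intro borel_measurable_times_ennreal borel_measurable_const meas, auto)
    also have "\<dots> = (\<integral>\<^sup>+ x. ennreal (R k x) * indicator ?E x \<partial>PiM {..<k} (\<lambda>_. \<mu>))"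
    proof (rule nn_integral_cong)
      fix x assume x: "x \<in> space (PiM {..<k} (\<lambda>_. \<mu>))"
      have "ennreal (R k x) = (\<Sum>I\<in>Pow J. ennreal (?w I * ?D I {..<k} x))"
        unfolding R_def using D_nonneg x w_nonneg by (intro sum_ennreal[symmetric]) auto
      also have "\<dots> = (\<Sum>I\<in>Pow J. ennreal (?w I) * ennreal (?D I {..<k} x))"
        using D_nonneg x w_nonneg by (intro sum.cong ennreal_mult) auto
      finally show "(\<Sum>I\<in>Pow J. ennreal (?w I) * (ennreal (?D I {..<k} x) * indicator ?E x)) =
          ennreal (R k x) * indicator ?E x"
        by (simp add: sum_distrib_right mult.assoc)
    qed
    finally show "(\<integral>\<^sup>+ \<xi>. ?F \<xi> \<partial>P) = (\<integral>\<^sup>+ x \<in> ?E. ennreal (R k x) \<partial>PiM {..<k} (\<lambda>_. \<mu>))" .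
  qed
  have det: "cq_scalar (complex_of_real (R m x)) = moore_dyson_det m (\<lambda>i j. K (x i) (x j))"
    if "x \<in> PiE {..<m} (\<lambda>_. space \<mu>)" for m x
  proof -
    have x: "x i \<in> space \<mu>" if "i \<in> {..<m}" for i
      using that \<open>x \<in> PiE {..<m} (\<lambda>_. space \<mu>)\<close> by auto
    have "moore_dyson_det m (\<lambda>i j. K (x i) (x j)) =
        mdet (\<lambda>i j. kernel J (\<lambda>k. complex_of_real (lam k)) u (x i) (x j)) {..<m}"
      unfolding moore_dyson_det_eq_mdet using x K by (intro mdet_cong) auto
    also have "\<dots> = cq_scalar (pfdet (\<lambda>i j. kernel J (\<lambda>k. complex_of_real (lam k)) u (x i) (x j)) {..<m})"
      by (rule mdet_eq_pfdet) (auto intro: kernel_self_dual)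
    also have "\<dots> = cq_scalar (complex_of_real (R m x))"
      unfolding R_def by (subst pfdet_kernel_expansion[OF J pk finite_lessThan x]) auto
    finally show ?thesis by simp
  qed
  have "self_dual_kernel (space \<mu>) K"
    unfolding self_dual_kernel_def by (auto simp: K intro: kernel_self_dual)
  then have "pfaffian_point_field \<mu> K P"
    unfolding pfaffian_point_field_def using rpf corr det by blast
  then show ?thesis by blast
qed

end
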